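(* Let $P_n(x)=P_n(a,b,c;x)$ be the big $q$-Jacobi polynomials $$P_n(a,b,c;x)={}_3\phi_2\left({{q^{-n},\,abq^{n+1},\,x}\atop{qa,\ qc}};q,q\right).$$ Then for all nonnegative integers $m,n$, $$\int_{cq}^{aq}\frac{(x/a,x/c;q)_\infty}{(x,bx/c;q)_\infty}P_m(x)P_n(x)\,d_qx=aq(1-q)\frac{(q,abq^2,c/a,qa/c;q)_\infty}{(aq,bq,cq,abq/c;q)_\infty}\cdot\frac{(1-abq)(q,qb,abq/c;q)_n}{(1-abq^{2n+1})(aq,abq,cq;q)_n}\,(-acq^2)^n q^{n(n-1)/2}\,\delta_{mn}.$$
   Context: Here $q$ is a nonzero complex number with $|q|<1$, and $a,b,c$ are complex parameters such that no zero factors occur in denominators. Notation: $(x;q)_0=1$, $(x;q)_n=\prod_{k=0}^{n-1}(1-xq^k)$ for $n=1,2,\dots$ or $n=\infty$, and $(x_1,\dots,x_r;q)_n=(x_1;q)_n\cdots(x_r;q)_n$. The basic hypergeometric series is $${}_3\phi_2\left({{a_1,a_2,a_3}\atop{b_1,b_2}};q,z\right)=\sum_{k=0}^\infty\frac{(a_1,a_2,a_3;q)_k}{(q,b_1,b_2;q)_k}z^k.$$ The $q$-integral is $$\int_a^b f(x)\,d_qx=(1-q)\sum_{n=0}^\infty\left[bf(bq^n)-af(aq^n)\right]q^n,$$ and $\delta_{mn}$ is the Kronecker delta. *)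

theory Defs
  imports "HOL-Analysis.Analysis"
begin

definition qpoch :: "complex \<Rightarrow> complex \<Rightarrow> nat \<Rightarrow> complex" where
  "qpoch x q n = (\<Prod>k<n. 1 - x * q ^ k)"

definition qpoch_inf :: "complex \<Rightarrow> complex \<Rightarrow> complex" where
  "qpoch_inf x q = (\<Prod>k. 1 - x * q ^ k)"

text \<open>The multi-parameter symbols \<open>(x\<^sub>1, \<dots>, x\<^sub>r; q)\<^sub>n\<close> and
  \<open>(x\<^sub>1, \<dots>, x\<^sub>r; q)\<^sub>\<infinity>\<close>.\<close>

definition qpochs :: "complex list \<Rightarrow> complex \<Rightarrow> nat \<Rightarrow> complex" where
  "qpochs xs q n = (\<Prod>x\<leftarrow>xs. qpoch x q n)"

definition qpochs_inf :: "complex list \<Rightarrow> complex \<Rightarrow> complex" where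
  "qpochs_inf xs q = (\<Prod>x\<leftarrow>xs. qpoch_inf x q)"

definition phi32 ::
  "complex \<Rightarrow> complex \<Rightarrow> complex \<Rightarrow> complex \<Rightarrow> complex \<Rightarrow> complex \<Rightarrow> complex \<Rightarrow> complex" where
  "phi32 a1 a2 a3 b1 b2 q z =
     (\<Sum>k. qpochs [a1, a2, a3] q k / qpochs [q, b1, b2] q k * z ^ k)"

text \<open>The \<open>q\<close>-integral of \<open>f\<close> from \<open>a\<close> to \<open>b\<close>. As \<open>suminf\<close> is total, convergence of the
  defining series is recorded separately.\<close>

definition q_integrable :: "complex \<Rightarrow> complex \<Rightarrow> complex \<Rightarrow> (complex \<Rightarrow> complex) \<Rightarrow> bool" where
  "q_integrable q a b f \<longleftrightarrow> summable (\<lambda>n. (b * f (b * q ^ n) - a * f (a * q ^ n)) * q ^ n)"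

definition q_integral :: "complex \<Rightarrow> complex \<Rightarrow> complex \<Rightarrow> (complex \<Rightarrow> complex) \<Rightarrow> complex" where
  "q_integral q a b f = (1 - q) * (\<Sum>n. (b * f (b * q ^ n) - a * f (a * q ^ n)) * q ^ n)"

definition big_q_jacobi ::
  "complex \<Rightarrow> nat \<Rightarrow> complex \<Rightarrow> complex \<Rightarrow> complex \<Rightarrow> complex \<Rightarrow> complex" where
  "big_q_jacobi q n a b c x =
     phi32 (q powi (- int n)) (a * b * q ^ (n + 1)) x (q * a) (q * c) q q"

definition big_q_jacobi_weight ::
  "complex \<Rightarrow> complex \<Rightarrow> complex \<Rightarrow> complex \<Rightarrow> complex \<Rightarrow> complex" where
  "big_q_jacobi_weight q a b c x = qpochs_inf [x / a, x / c] q / qpochs_inf [x, b * x / c] q"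

end

theory Submission imports Defs "HOL-Computational_Algebra.Polynomial" begin

text \<open>
  The orthogonality rests on integrals of the weight \<open>w(x) = (x/a, x/c; q)\<^sub>\<infinity> / (x, bx/c; q)\<^sub>\<infinity>\<close> against
  suitable products, all of which are instances of one closed formula, and on one finite summation.
  
  The closed formula is the Andrews--Askey \<open>q\<close>-beta integral \<open>Andrews_Askey\<close> for the kernel
  \<open>(x/a, x/c; q)\<^sub>\<infinity> / (\<alpha>x, \<beta>x; q)\<^sub>\<infinity>\<close>.  A telescoping sum relates the parameter values \<open>\<alpha>\<close> and \<open>\<alpha>q\<close>
  (\<open>aa_integral_contiguous\<close>); iterating it drives \<open>\<alpha>\<close>, and then \<open>\<beta>\<close>, to \<open>0\<close>.  What is left is a
  constant depending only on \<open>a\<close> and \<open>c\<close>, which is read off at \<open>\<alpha> = 1/a\<close>, \<open>\<beta> = 0\<close>, where the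
  integrand reduces to \<open>(x/c; q)\<^sub>\<infinity>\<close> and the integral telescopes.
  
  The family of kernels is closed under two multiplications.  The factor \<open>(x; q)\<^sub>k\<close> replaces \<open>\<alpha> = 1\<close> by
  \<open>q\<^sup>k\<close>, and the factor \<open>T\<^sub>j(x) = (x/(aq\<^sup>j); q)\<^sub>j\<close> replaces \<open>a\<close> by \<open>aq\<^sup>j\<close>; the latter also fits the range
  of integration, because \<open>T\<^sub>j\<close> vanishes at the first \<open>j\<close> nodes of the lattice that starts at \<open>aq\<close>.  So
  every integral of \<open>w(x) (x; q)\<^sub>k T\<^sub>j(x)\<close> is an explicit quotient of shifted factorials
  (\<open>mixed_moment\<close>).  As \<open>T\<^sub>j\<close> has exact degree \<open>j\<close> for every \<open>b\<close>, including \<open>b = 0\<close>, the \<open>T\<^sub>j\<close> can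
  serve as test polynomials.
  
  Expanding \<open>P\<^sub>n\<close> in the \<open>(x; q)\<^sub>k\<close> turns the integral of \<open>w P\<^sub>n T\<^sub>j\<close>, \<open>j \<le> n\<close>, into the sum over \<open>k\<close> of
  \<open>(q\<^sup>-\<^sup>n; q)\<^sub>k / (q; q)\<^sub>k q\<^sup>k\<close> times a product of \<open>n\<close> linear factors \<open>1 - c\<^sub>i q\<^sup>k\<close>, divided by \<open>1 - z q\<^sup>k\<close> with
  \<open>z = abq\<^sup>j\<^sup>+\<^sup>1\<close>.  Such a sum is proportional to the product of the \<open>z - c\<^sub>i\<close>
  (\<open>qdiff_product_over_linear\<close>).  For \<open>j < n\<close> one of the \<open>c\<^sub>i\<close> is \<open>z\<close> itself, so the integral vanishes
  and \<open>P\<^sub>n\<close> is orthogonal to all polynomials of smaller degree.  For \<open>j = n\<close> the product is a shifted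
  factorial, and comparing the leading coefficients of \<open>P\<^sub>n\<close> and \<open>T\<^sub>n\<close> gives the norm.
\<close>

section \<open>Shifted factorials\<close>

lemma qpoch_0 [simp]: "qpoch x q 0 = 1"
  by (simp add: qpoch_def)

lemma qpoch_Suc: "qpoch x q (Suc n) = qpoch x q n * (1 - x * q ^ n)"
  by (simp add: qpoch_def)

lemma qpoch_add: "qpoch x q (m + n) = qpoch x q m * qpoch (x * q ^ m) q n"
  by (induction n) (simp_all add: qpoch_Suc power_add mult.assoc)

lemma qpoch_Suc_shift: "qpoch x q (Suc n) = (1 - x) * qpoch (x * q) q n"
  using qpoch_add[of x q 1 n] by (simp add: qpoch_Suc)

lemma qpoch_eq_0_iff: "qpoch x q n = 0 \<longleftrightarrow> (\<exists>k<n. x * q ^ k = 1)"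
  by (auto simp: qpoch_def)

lemma qpoch_nonzero: "(\<And>k. x * q ^ k \<noteq> 1) \<Longrightarrow> qpoch x q n \<noteq> 0"
  by (simp add: qpoch_eq_0_iff)

lemma power_Suc_neq_1:
  fixes q :: complex
  assumes "norm q < 1"
  shows "q ^ Suc k \<noteq> 1"
proof
  assume "q ^ Suc k = 1"
  hence "norm q ^ Suc k = 1" by (metis norm_power norm_one)
  moreover have "norm q ^ Suc k < 1"
  proof -
    have "norm q * norm q ^ k \<le> norm q * 1"
      using assms by (intro mult_left_mono power_le_one) auto
    with assms show ?thesis by simp
  qed
  ultimately show False by simp
qed

lemma qpoch_q_nonzero: "norm q < 1 \<Longrightarrow> qpoch q q n \<noteq> 0"
  using power_Suc_neq_1[of q] by (intro qpoch_nonzero) simp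

context
  fixes q :: complex
  assumes q1: "norm q < 1"
begin

lemma convergent_prod_qpoch: "convergent_prod (\<lambda>k. 1 - x * q ^ k)"
proof (rule abs_convergent_prod_imp_convergent_prod)
  have "summable (\<lambda>k. norm x * norm q ^ k)"
    using q1 by (intro summable_mult summable_geometric) simp
  thus "abs_convergent_prod (\<lambda>k. 1 - x * q ^ k)"
    by (simp add: abs_convergent_prod_conv_summable norm_mult norm_power)
qed

lemma qpoch_tendsto_qpoch_inf: "(\<lambda>n. qpoch x q n) \<longlonglongrightarrow> qpoch_inf x q"
  using convergent_prod_LIMSEQ[OF convergent_prod_qpoch[of x]]
  unfolding qpoch_def qpoch_inf_def by (simp add: LIMSEQ_lessThan_iff_atMost)

lemma qpoch_inf_split: "qpoch_inf x q = qpoch x q n * qpoch_inf (x * q ^ n) q"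
proof (rule LIMSEQ_unique)
  show "(\<lambda>m. qpoch x q (n + m)) \<longlonglongrightarrow> qpoch_inf x q"
    using LIMSEQ_ignore_initial_segment[OF qpoch_tendsto_qpoch_inf, of x n]
    by (simp add: add.commute)
  show "(\<lambda>m. qpoch x q (n + m)) \<longlonglongrightarrow> qpoch x q n * qpoch_inf (x * q ^ n) q"
    unfolding qpoch_add by (intro tendsto_intros qpoch_tendsto_qpoch_inf)
qed

lemma qpoch_inf_step: "qpoch_inf x q = (1 - x) * qpoch_inf (x * q) q"
  using qpoch_inf_split[of x 1] by (simp add: qpoch_Suc)

lemma qpoch_inf_0 [simp]: "qpoch_inf 0 q = 1"
  by (simp add: qpoch_inf_def)

lemma qpoch_inf_1 [simp]: "qpoch_inf 1 q = 0"
  by (subst qpoch_inf_step) simp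

lemma qpoch_inf_nonzero: "(\<And>k. x * q ^ k \<noteq> 1) \<Longrightarrow> qpoch_inf x q \<noteq> 0"
  unfolding qpoch_inf_def by (intro prodinf_nonzero convergent_prod_qpoch) simp

lemma power_tendsto_0: "(\<lambda>n. x * q ^ n) \<longlonglongrightarrow> 0"
  using q1 by (intro tendsto_mult_right_zero LIMSEQ_power_zero)

text \<open>
  Far enough out the factors \<open>1 - xq\<^sup>n\<^sup>+\<^sup>k\<close> do not vanish, and there \<open>(xq\<^sup>n; q)\<^sub>\<infinity>\<close> is the quotient of the
  infinite product by its \<open>n\<close>-th partial product.
\<close>

lemma qpoch_inf_tendsto_1: "(\<lambda>n. qpoch_inf (x * q ^ n) q) \<longlonglongrightarrow> 1"
proof -
  have "\<forall>\<^sub>F n in sequentially. norm (x * q ^ n) < 1"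
    using order_tendstoD(2)[OF tendsto_norm_zero[OF power_tendsto_0[of x]], of 1] by simp
  then obtain N where N: "norm (x * q ^ N) < 1"
    by (auto simp: eventually_sequentially)
  define y where "y = x * q ^ N"
  have "y * q ^ k \<noteq> 1" for k
  proof
    assume "y * q ^ k = 1"
    hence "norm y * norm q ^ k = 1" by (metis norm_mult norm_power norm_one)
    moreover have "norm y * norm q ^ k \<le> norm y * 1"
      using q1 by (intro mult_left_mono power_le_one) auto
    ultimately show False using N by (simp add: y_def)
  qed
  hence nz: "qpoch_inf y q \<noteq> 0" "qpoch y q n \<noteq> 0" for n
    using qpoch_inf_nonzero[of y] qpoch_nonzero[of y q n] by blast+
  have "(\<lambda>n. qpoch_inf y q / qpoch y q n) \<longlonglongrightarrow> qpoch_inf y q / qpoch_inf y q"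
    by (intro tendsto_intros qpoch_tendsto_qpoch_inf nz)
  moreover have "qpoch_inf y q / qpoch y q n = qpoch_inf (x * q ^ (n + N)) q" for n
    using qpoch_inf_split[of y n] nz(2)[of n] by (simp add: y_def power_add mult_ac)
  ultimately have "(\<lambda>n. qpoch_inf (x * q ^ (n + N)) q) \<longlonglongrightarrow> 1"
    using nz by simp
  thus ?thesis by (rule LIMSEQ_offset)
qed

section \<open>The \<open>q\<close>-integral\<close>

lemma summable_times_power:
  assumes "convergent (f :: nat \<Rightarrow> complex)"
  shows "summable (\<lambda>n. f n * q ^ n)"
proof -
  obtain M where M: "norm (f n) \<le> M" for n
    using convergent_imp_Bseq[OF assms] by (auto simp: Bseq_def)
  have "summable (\<lambda>n. M * norm q ^ n)"
    using q1 by (intro summable_mult summable_geometric) simp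
  thus ?thesis
    by (rule summable_comparison_test'[where N = 0])
       (auto simp: norm_mult norm_power intro!: mult_right_mono M)
qed

lemma q_integrableI:
  assumes "convergent (\<lambda>n. f (a * q ^ n))" "convergent (\<lambda>n. f (b * q ^ n))"
  shows "q_integrable q a b f"
  unfolding q_integrable_def
  by (intro summable_times_power convergent_diff convergent_mult convergent_const assms)

lemma q_integral_lincomb:
  assumes "q_integrable q a b f" "q_integrable q a b g"
  shows "q_integral q a b (\<lambda>x. s * f x + t * g x) = s * q_integral q a b f + t * q_integral q a b g"
proof -
  let ?F = "\<lambda>n. (b * f (b * q ^ n) - a * f (a * q ^ n)) * q ^ n"
  let ?G = "\<lambda>n. (b * g (b * q ^ n) - a * g (a * q ^ n)) * q ^ n"
  have "(\<lambda>n. s * ?F n + t * ?G n) sums (s * suminf ?F + t * suminf ?G)"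
    using assms unfolding q_integrable_def
    by (intro sums_add sums_mult summable_sums)
  hence "(\<Sum>n. s * ?F n + t * ?G n) = s * suminf ?F + t * suminf ?G"
    by (rule sums_unique[symmetric])
  thus ?thesis unfolding q_integral_def by (simp add: algebra_simps)
qed

lemma q_integral_cong:
  assumes "\<And>n. f (a * q ^ n) = g (a * q ^ n)" "\<And>n. f (b * q ^ n) = g (b * q ^ n)"
  shows "q_integral q a b f = q_integral q a b g"
  using assms by (simp add: q_integral_def)

lemma q_integral_swap:
  assumes "q_integrable q a b f"
  shows "q_integral q b a f = - q_integral q a b f"
proof -
  have "(\<Sum>n. (a * f (a * q ^ n) - b * f (b * q ^ n)) * q ^ n)
      = (\<Sum>n. - ((b * f (b * q ^ n) - a * f (a * q ^ n)) * q ^ n))"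
    by (intro arg_cong[where f = suminf] ext) (simp add: algebra_simps)
  also have "\<dots> = - (\<Sum>n. (b * f (b * q ^ n) - a * f (a * q ^ n)) * q ^ n)"
    using assms unfolding q_integrable_def by (rule suminf_minus)
  finally show ?thesis by (simp add: q_integral_def)
qed

text \<open>
  The lattice of the integral from \<open>cq\<close> to \<open>aq\<close> starts one step inside \<open>a\<close> and \<open>c\<close>.  If \<open>x h(x)\<close> is the
  difference of \<open>g\<close> between \<open>x/q\<close> and \<open>x\<close>, the boundary terms therefore sit at \<open>a\<close> and \<open>c\<close> themselves,
  where kernels containing \<open>(x/a, x/c; q)\<^sub>\<infinity>\<close> vanish; the limits at the origin cancel.
\<close>

lemma q_integral_telescope:
  assumes a: "\<And>n. a * q ^ Suc n * h (a * q ^ Suc n) = g (a * q ^ n) - g (a * q ^ Suc n)"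
    and c: "\<And>n. c * q ^ Suc n * h (c * q ^ Suc n) = g (c * q ^ n) - g (c * q ^ Suc n)"
    and lim: "(\<lambda>n. g (a * q ^ n)) \<longlonglongrightarrow> l" "(\<lambda>n. g (c * q ^ n)) \<longlonglongrightarrow> l"
  shows "q_integral q (c * q) (a * q) h = (1 - q) * (g a - g c)"
proof -
  let ?d = "\<lambda>x n. g (x * q ^ n) - g (x * q ^ Suc n)"
  have "(\<lambda>n. ?d a n - ?d c n) sums ((g (a * q ^ 0) - l) - (g (c * q ^ 0) - l))"
    by (intro sums_diff telescope_sums' lim)
  moreover have "(a * q * h (a * q * q ^ n) - c * q * h (c * q * q ^ n)) * q ^ n = ?d a n - ?d c n" for n
    unfolding a[symmetric] c[symmetric] by (simp add: algebra_simps)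
  ultimately have "(\<lambda>n. (a * q * h (a * q * q ^ n) - c * q * h (c * q * q ^ n)) * q ^ n) sums (g a - g c)"
    by simp
  thus ?thesis unfolding q_integral_def by (simp add: sums_iff)
qed

end

lemma q_integral_shift_upper:
  assumes q1: "norm q < 1"
    and conv: "convergent (\<lambda>n. f (a * q ^ n))" "convergent (\<lambda>n. f (b * q ^ n))"
    and zero: "\<And>i. i < j \<Longrightarrow> f (b * q ^ i) = 0"
  shows "q_integral q a (b * q ^ j) f = q_integral q a b f"
proof -
  let ?A = "\<lambda>n. a * f (a * q ^ n) * q ^ n" and ?B = "\<lambda>n. b * f (b * q ^ n) * q ^ n"
  have A: "summable ?A" and B: "summable ?B"
    by (intro summable_times_power q1 convergent_mult convergent_const conv)+
  have Bj: "(\<lambda>n. ?B (n + j)) sums suminf ?B"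
    using sums_split_initial_segment[OF summable_sums[OF B], of j] zero by simp
  have "(\<lambda>n. ?B (n + j) - ?A n) sums (suminf ?B - suminf ?A)"
    by (intro sums_diff Bj summable_sums A)
  moreover have "(\<lambda>n. ?B n - ?A n) sums (suminf ?B - suminf ?A)"
    by (intro sums_diff summable_sums A B)
  moreover have "?B (n + j) - ?A n
      = (b * q ^ j * f (b * q ^ j * q ^ n) - a * f (a * q ^ n)) * q ^ n" for n
    by (simp add: power_add algebra_simps)
  ultimately show ?thesis
    unfolding q_integral_def by (simp add: sums_iff left_diff_distrib)
qed

section \<open>A finite \<open>q\<close>-difference functional\<close>

text \<open>
  Up to normalization this is the \<open>n\<close>-th \<open>q\<close>-difference: it annihilates \<open>f(k) = (q\<^sup>k)\<^sup>s\<close> for \<open>s < n\<close>.  Every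
  terminating basic hypergeometric series with numerator parameter \<open>q\<^sup>-\<^sup>n\<close> and argument \<open>q\<close> is of this
  form.  The parameter is written \<open>inverse q ^ n\<close> so that the recursions in \<open>n\<close> are recursions of powers.
\<close>

definition qdiff :: "complex \<Rightarrow> nat \<Rightarrow> (nat \<Rightarrow> complex) \<Rightarrow> complex" where
  "qdiff q n f = (\<Sum>k\<le>n. qpoch (inverse q ^ n) q k / qpoch q q k * q ^ k * f k)"

lemma qpoch_neg_eq_0:
  assumes "q \<noteq> 0" "n < k"
  shows "qpoch (inverse q ^ n) q k = 0"
proof -
  have "inverse q ^ n * q ^ n = 1"
    using assms by (simp flip: power_mult_distrib)
  with assms show ?thesis by (auto simp: qpoch_eq_0_iff)
qed

context
  fixes q :: complex
  assumes q0: "q \<noteq> 0" and q1: "norm q < 1"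
begin

private abbreviation (input) d :: "nat \<Rightarrow> nat \<Rightarrow> complex" where
  "d n k \<equiv> qpoch (inverse q ^ n) q k / qpoch q q k * q ^ k"

lemma qdiff_extend: "qdiff q n f = (\<Sum>k\<le>Suc n. d n k * f k)"
  using qpoch_neg_eq_0[OF q0, of n "Suc n"] by (simp add: qdiff_def)

text \<open>
  These are the two \<open>q\<close>-Pascal rules for the \<open>q\<close>-binomial coefficients hidden in the weights.  They give
  two recursions in \<open>n\<close> for the functional, one for \<open>f(k)\<close> and one for \<open>q\<^sup>k f(k)\<close>.
\<close>

lemma coefficient_Pascal:
  "d (Suc n) (Suc k) = d n (Suc k) - inverse q ^ n * d n k"
  "d (Suc n) (Suc k) * q ^ Suc k = d n (Suc k) - q * d n k"
proof -
  define Q where "Q = inverse q ^ n"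
  define P where "P = qpoch Q q k"
  define R where "R = qpoch q q k"
  have nz: "R \<noteq> 0" "1 - q ^ Suc k \<noteq> 0"
    using qpoch_q_nonzero[OF q1, of k] power_Suc_neq_1[OF q1, of k] by (auto simp: R_def)
  have 1: "qpoch (inverse q ^ Suc n) q (Suc k) = (1 - Q / q) * P"
    unfolding qpoch_Suc_shift using q0 by (simp add: Q_def P_def field_simps)
  have 2: "qpoch Q q (Suc k) = P * (1 - Q * q ^ k)"
    by (simp add: P_def qpoch_Suc)
  have 3: "qpoch q q (Suc k) = R * (1 - q ^ Suc k)"
    by (simp add: R_def qpoch_Suc)
  show "d (Suc n) (Suc k) = d n (Suc k) - inverse q ^ n * d n k"
    unfolding 1 3 Q_def[symmetric] 2 P_def[symmetric] R_def[symmetric] using nz q0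
    by (simp add: divide_simps) (simp add: algebra_simps)
  show "d (Suc n) (Suc k) * q ^ Suc k = d n (Suc k) - q * d n k"
    unfolding 1 3 Q_def[symmetric] 2 P_def[symmetric] R_def[symmetric] using nz q0
    by (simp add: divide_simps) (simp add: algebra_simps)
qed

lemma qdiff_Suc: "qdiff q (Suc n) f = qdiff q n f - inverse q ^ n * qdiff q n (\<lambda>k. f (Suc k))"
proof -
  have "qdiff q (Suc n) f = d (Suc n) 0 * f 0 + (\<Sum>k\<le>n. d (Suc n) (Suc k) * f (Suc k))"
    unfolding qdiff_def by (rule sum.atMost_Suc_shift)
  also have "(\<Sum>k\<le>n. d (Suc n) (Suc k) * f (Suc k))
      = (\<Sum>k\<le>n. d n (Suc k) * f (Suc k)) - inverse q ^ n * qdiff q n (\<lambda>k. f (Suc k))"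
    unfolding coefficient_Pascal(1) qdiff_def
    by (simp add: algebra_simps sum_subtractf sum_distrib_left)
  also have "d (Suc n) 0 * f 0 + \<dots> = (\<Sum>k\<le>Suc n. d n k * f k)
      - inverse q ^ n * qdiff q n (\<lambda>k. f (Suc k))"
    by (simp add: sum.atMost_Suc_shift del: sum.atMost_Suc)
  finally show ?thesis by (simp only: qdiff_extend)
qed

lemma qdiff_Suc_power:
  "qdiff q (Suc n) (\<lambda>k. q ^ k * f k) = qdiff q n f - q * qdiff q n (\<lambda>k. f (Suc k))"
proof -
  have "qdiff q (Suc n) (\<lambda>k. q ^ k * f k)
      = d (Suc n) 0 * (q ^ 0 * f 0) + (\<Sum>k\<le>n. d (Suc n) (Suc k) * (q ^ Suc k * f (Suc k)))"
    unfolding qdiff_def by (rule sum.atMost_Suc_shift)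
  also have "(\<Sum>k\<le>n. d (Suc n) (Suc k) * (q ^ Suc k * f (Suc k)))
      = (\<Sum>k\<le>n. d (Suc n) (Suc k) * q ^ Suc k * f (Suc k))"
    by (simp only: mult.assoc)
  also have "\<dots> = (\<Sum>k\<le>n. d n (Suc k) * f (Suc k)) - q * qdiff q n (\<lambda>k. f (Suc k))"
    unfolding coefficient_Pascal(2) qdiff_def
    by (simp add: algebra_simps sum_subtractf sum_distrib_left)
  also have "d (Suc n) 0 * (q ^ 0 * f 0) + \<dots> = (\<Sum>k\<le>Suc n. d n k * f k)
      - q * qdiff q n (\<lambda>k. f (Suc k))"
    by (simp add: sum.atMost_Suc_shift del: sum.atMost_Suc)
  finally show ?thesis by (simp only: qdiff_extend)
qed

lemma qdiff_cmult: "qdiff q n (\<lambda>k. s * f k) = s * qdiff q n f"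
  by (simp add: qdiff_def sum_distrib_left mult_ac)

lemma qdiff_diff: "qdiff q n (\<lambda>k. f k - g k) = qdiff q n f - qdiff q n g"
  by (simp add: qdiff_def sum_subtractf right_diff_distrib)

text \<open>
  Up to the factor \<open>(q; q)\<^sub>n\<close> this is the partial fraction expansion of \<open>z\<^sup>n\<^sup>-\<^sup>s / (z; q)\<^sub>n\<^sub>+\<^sub>1\<close> in \<open>z\<close>.  Shifting \<open>k\<close> replaces \<open>z\<close> by \<open>zq\<close>, so the
  family is stable under both recursions: the second lowers \<open>s\<close>, and the first serves for \<open>s = 0\<close>.
\<close>

lemma qdiff_power_over_linear:
  assumes "\<And>k. z * q ^ k \<noteq> 1" "s \<le> n"
  shows "qdiff q n (\<lambda>k. (q ^ k) ^ s / (1 - z * q ^ k)) = z ^ (n - s) * qpoch q q n / qpoch z q (Suc n)"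
  using assms
proof (induction n arbitrary: z s)
  case 0
  thus ?case by (simp add: qdiff_def qpoch_Suc)
next
  case (Suc n)
  have nz: "1 - z * q ^ k \<noteq> 0" for k using Suc.prems(1)[of k] by simp
  define C where "C = qpoch (z * q) q n"
  have C: "C \<noteq> 0"
    unfolding C_def using Suc.prems(1)[of "Suc _"] by (intro qpoch_nonzero) (simp add: mult_ac)
  have C1: "qpoch z q (Suc n) = (1 - z) * C" "qpoch (z * q) q (Suc n) = C * (1 - z * q ^ Suc n)"
    "qpoch z q (Suc (Suc n)) = (1 - z) * C * (1 - z * q ^ Suc n)"
    unfolding C_def qpoch_Suc_shift[of z] by (simp_all add: qpoch_Suc mult_ac)
  have Q: "qpoch q q (Suc n) = qpoch q q n * (1 - q ^ Suc n)"
    by (simp add: qpoch_Suc)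
  have shifted: "z * q * q ^ k \<noteq> 1" for k
    using Suc.prems(1)[of "Suc k"] by (simp add: mult_ac)
  have nz0: "1 - z \<noteq> 0" using nz[of 0] by simp
  have IH: "qdiff q n (\<lambda>k. (q ^ k) ^ s / (1 - z * q ^ k)) = z ^ (n - s) * qpoch q q n / ((1 - z) * C)"
    "qdiff q n (\<lambda>k. (q ^ Suc k) ^ s / (1 - z * q ^ Suc k))
      = q ^ s * ((z * q) ^ (n - s) * qpoch q q n / (C * (1 - z * q ^ Suc n)))" if "s \<le> n" for s
  proof -
    show "qdiff q n (\<lambda>k. (q ^ k) ^ s / (1 - z * q ^ k)) = z ^ (n - s) * qpoch q q n / ((1 - z) * C)"
      using Suc.IH[OF Suc.prems(1) that] C1 by simp
    have "qdiff q n (\<lambda>k. q ^ s * ((q ^ k) ^ s / (1 - z * q * q ^ k)))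
      = q ^ s * ((z * q) ^ (n - s) * qpoch q q n / (C * (1 - z * q ^ Suc n)))"
      unfolding qdiff_cmult Suc.IH[OF shifted that] C1 ..
    thus "qdiff q n (\<lambda>k. (q ^ Suc k) ^ s / (1 - z * q ^ Suc k))
      = q ^ s * ((z * q) ^ (n - s) * qpoch q q n / (C * (1 - z * q ^ Suc n)))"
      by (simp add: power_mult_distrib mult_ac)
  qed
  show ?case
  proof (cases s)
    case 0
    show ?thesis
      unfolding qdiff_Suc 0 IH[OF le0] C1 Q using C nz0 nz[of "Suc n"] q0
      by (simp add: divide_simps power_mult_distrib) (simp add: algebra_simps)
  next
    case [simp]: (Suc t)
    with Suc.prems have t: "t \<le> n" by simp
    then obtain r where r: "n = t + r" using le_Suc_ex by blast
    have "qdiff q (Suc n) (\<lambda>k. (q ^ k) ^ s / (1 - z * q ^ k))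
        = qdiff q (Suc n) (\<lambda>k. q ^ k * ((q ^ k) ^ t / (1 - z * q ^ k)))"
      by simp
    also have "\<dots> = z ^ (Suc n - s) * qpoch q q (Suc n) / qpoch z q (Suc (Suc n))"
      unfolding qdiff_Suc_power IH[OF t] C1 Q using C nz0 nz[of "Suc n"] q0
      by (simp add: divide_simps power_mult_distrib r power_add) (simp add: algebra_simps)
    finally show ?thesis .
  qed
qed

text \<open>
  By linearity a polynomial in \<open>q\<^sup>k\<close> of degree at most \<open>n\<close> enters through its homogenization evaluated at
  \<open>z\<close>; a product of linear factors thus becomes the product of the \<open>z - c i\<close>.  The extra power \<open>s\<close> is
  needed for the induction, since each new factor \<open>1 - c r * q ^ k\<close> splits off a term with one more
  power of \<open>q\<^sup>k\<close>.
\<close>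

lemma qdiff_product_over_linear:
  assumes "\<And>k. z * q ^ k \<noteq> 1" "r + s \<le> n"
  shows "qdiff q n (\<lambda>k. (q ^ k) ^ s * (\<Prod>i<r. 1 - c i * q ^ k) / (1 - z * q ^ k))
    = z ^ (n - r - s) * (\<Prod>i<r. z - c i) * qpoch q q n / qpoch z q (Suc n)"
  using assms(2)
proof (induction r arbitrary: s)
  case 0
  thus ?case using qdiff_power_over_linear[OF assms(1), of s n] by simp
next
  case (Suc r)
  let ?P = "\<lambda>s k. (q ^ k) ^ s * (\<Prod>i<r. 1 - c i * q ^ k) / (1 - z * q ^ k)"
  have "(q ^ k) ^ s * (\<Prod>i<Suc r. 1 - c i * q ^ k) / (1 - z * q ^ k)
      = ?P s k - c r * ?P (Suc s) k" for k
    using assms(1)[of k] by (simp add: diff_divide_distrib[symmetric] algebra_simps)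
  hence "qdiff q n (\<lambda>k. (q ^ k) ^ s * (\<Prod>i<Suc r. 1 - c i * q ^ k) / (1 - z * q ^ k))
      = qdiff q n (?P s) - c r * qdiff q n (?P (Suc s))"
    by (simp only: qdiff_diff qdiff_cmult)
  also have "\<dots> = z ^ (n - r - s) * (\<Prod>i<r. z - c i) * qpoch q q n / qpoch z q (Suc n)
      - c r * (z ^ (n - r - Suc s) * (\<Prod>i<r. z - c i) * qpoch q q n / qpoch z q (Suc n))"
    using Suc.prems by (subst (1 2) Suc.IH) simp_all
  also have "n - r - s = Suc (n - Suc r - s)"
    using Suc.prems by simp
  also have "n - r - Suc s = n - Suc r - s"
    using Suc.prems by simp
  finally show ?case
    by (simp add: diff_divide_distrib[symmetric] algebra_simps)
qed

end

section \<open>The Andrews--Askey integral\<close>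

definition aa_kernel ::
  "complex \<Rightarrow> complex \<Rightarrow> complex \<Rightarrow> complex \<Rightarrow> complex \<Rightarrow> complex \<Rightarrow> complex" where
  "aa_kernel q a c \<alpha> \<beta> x =
     qpoch_inf (x / a) q * qpoch_inf (x / c) q / (qpoch_inf (\<alpha> * x) q * qpoch_inf (\<beta> * x) q)"

abbreviation aa_integral ::
  "complex \<Rightarrow> complex \<Rightarrow> complex \<Rightarrow> complex \<Rightarrow> complex \<Rightarrow> complex" where
  "aa_integral q a c \<alpha> \<beta> \<equiv> q_integral q (c * q) (a * q) (aa_kernel q a c \<alpha> \<beta>)"

text \<open>
  The value of the Andrews--Askey integral at \<open>\<alpha> = \<beta> = 0\<close>.  The form \<open>(a - c) (cq/a; q)\<^sub>\<infinity> (aq/c; q)\<^sub>\<infinity>\<close>,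
  rather than \<open>a (c/a; q)\<^sub>\<infinity> (aq/c; q)\<^sub>\<infinity>\<close>, makes the antisymmetry in \<open>a\<close> and \<open>c\<close> evident.
\<close>

definition aa_const :: "complex \<Rightarrow> complex \<Rightarrow> complex \<Rightarrow> complex" where
  "aa_const q a c = q * (1 - q) * (a - c) *
     (qpoch_inf q q * qpoch_inf (c * q / a) q * qpoch_inf (a * q / c) q)"

context
  fixes q :: complex
  assumes q0: "q \<noteq> 0" and q1: "norm q < 1"
begin

lemma aa_kernel_tendsto_1: "(\<lambda>n. aa_kernel q a c \<alpha> \<beta> (x * q ^ n)) \<longlonglongrightarrow> 1"
proof -
  have "(\<lambda>n. qpoch_inf (x / a * q ^ n) q * qpoch_inf (x / c * q ^ n) q /
     (qpoch_inf (\<alpha> * x * q ^ n) q * qpoch_inf (\<beta> * x * q ^ n) q)) \<longlonglongrightarrow> 1 * 1 / (1 * 1)"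
    by (intro tendsto_intros qpoch_inf_tendsto_1[OF q1]) simp
  thus ?thesis by (simp add: aa_kernel_def mult_ac)
qed

lemma aa_kernel_integrable: "q_integrable q s t (aa_kernel q a c \<alpha> \<beta>)"
  using aa_kernel_tendsto_1 by (intro q_integrableI[OF q1] convergentI)

lemma aa_kernel_commute: "aa_kernel q a c \<alpha> \<beta> = aa_kernel q a c \<beta> \<alpha>"
  by (simp add: aa_kernel_def fun_eq_iff mult_ac)

lemma aa_kernel_swap: "aa_kernel q a c \<alpha> \<beta> = aa_kernel q c a \<alpha> \<beta>"
  by (simp add: aa_kernel_def fun_eq_iff mult_ac)

lemma aa_kernel_step:
  assumes "\<And>k. \<alpha> * x * q ^ k \<noteq> 1"
  shows "aa_kernel q a c (\<alpha> * q) \<beta> x = (1 - \<alpha> * x) * aa_kernel q a c \<alpha> \<beta> x"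
proof -
  have "1 - \<alpha> * x \<noteq> 0" using assms[of 0] by simp
  moreover have "qpoch_inf (\<alpha> * x) q = (1 - \<alpha> * x) * qpoch_inf (\<alpha> * q * x) q"
    using qpoch_inf_step[OF q1, of "\<alpha> * x"] by (simp add: mult_ac)
  ultimately show ?thesis by (simp add: aa_kernel_def)
qed

text \<open>
  The combination of the kernels for \<open>\<alpha>\<close> and \<open>\<alpha>q\<close> that occurs here is, after multiplication by \<open>x\<close>,
  a difference of a multiple of the kernel with parameters \<open>\<alpha>q\<close> and \<open>\<beta>q\<close>, which vanishes at \<open>a\<close> and \<open>c\<close>.
\<close>

lemma aa_integral_contiguous:
  assumes a: "a \<noteq> 0" and c: "c \<noteq> 0"
    and nz: "\<And>k. \<alpha> * a * q ^ Suc k \<noteq> 1" "\<And>k. \<alpha> * c * q ^ Suc k \<noteq> 1"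
      "\<And>k. \<beta> * a * q ^ Suc k \<noteq> 1" "\<And>k. \<beta> * c * q ^ Suc k \<noteq> 1"
  shows "(1 - \<alpha> * a * q) * (1 - \<alpha> * c * q) * aa_integral q a c \<alpha> \<beta>
    = (1 - \<alpha> * \<beta> * a * c * q\<^sup>2) * aa_integral q a c (\<alpha> * q) \<beta>"
proof -
  have distr: "K * (u - v) * w = K * (u * w) - K * (v * w)" for K u v w :: complex
    by (simp add: algebra_simps)
  define s where "s = (1 - \<alpha> * a * q) * (1 - \<alpha> * c * q)"
  define t where "t = 1 - \<alpha> * \<beta> * a * c * q\<^sup>2"
  define h where "h = (\<lambda>x. s * aa_kernel q a c \<alpha> \<beta> x + (- t) * aa_kernel q a c (\<alpha> * q) \<beta> x)"
  define g where "g = (\<lambda>x. \<alpha> * a * c * q\<^sup>2 * aa_kernel q a c (\<alpha> * q) (\<beta> * q) x)"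
  have step: "y * q * h (y * q) = g y - g (y * q)"
    if y: "\<And>k. \<alpha> * y * q ^ Suc k \<noteq> 1" "\<And>k. \<beta> * y * q ^ Suc k \<noteq> 1" for y
  proof -
    define x where "x = y * q"
    define w where "w = aa_kernel q a c \<alpha> \<beta> x"
    have x1: "\<And>k. \<alpha> * x * q ^ k \<noteq> 1" "\<And>k. \<beta> * x * q ^ k \<noteq> 1"
      using y by (auto simp: x_def mult_ac)
    have w1: "aa_kernel q a c (\<alpha> * q) \<beta> x = (1 - \<alpha> * x) * w"
      unfolding w_def by (rule aa_kernel_step) (rule x1)
    have "aa_kernel q a c (\<alpha> * q) (\<beta> * q) x = (1 - \<beta> * x) * aa_kernel q a c (\<alpha> * q) \<beta> x"
      using aa_kernel_step[OF x1(2), of a c "\<alpha> * q"] by (simp only: aa_kernel_commute)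
    hence gx: "g (y * q) = \<alpha> * a * c * q\<^sup>2 * ((1 - \<alpha> * x) * (1 - \<beta> * x) * w)"
      unfolding g_def x_def[symmetric] w1 by simp
    have gy: "g y = \<alpha> * a * c * q\<^sup>2 * ((1 - y / a) * (1 - y / c) * w)"
      unfolding g_def w_def aa_kernel_def x_def
      using qpoch_inf_step[OF q1, of "y / a"] qpoch_inf_step[OF q1, of "y / c"]
      by (simp add: mult_ac)
    have "x * h x = x * (s - t * (1 - \<alpha> * x)) * w"
      unfolding h_def w1 w_def[symmetric] by (simp add: algebra_simps)
    \<comment> \<open>Going from x to y = x/q multiplies the numerator of the kernel by (1 - y/a)(1 - y/c); going from
       (\<alpha>q, \<beta>q) to (\<alpha>, \<beta>) removes (1 - \<alpha>x)(1 - \<beta>x).\<close>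
    also have "x * (s - t * (1 - \<alpha> * x))
        = \<alpha> * a * c * q\<^sup>2 * ((1 - y / a) * (1 - y / c) - (1 - \<alpha> * x) * (1 - \<beta> * x))"
      using a c unfolding s_def t_def x_def by (simp add: field_simps power2_eq_square)
    finally have "x * h x = \<alpha> * a * c * q\<^sup>2 * ((1 - y / a) * (1 - y / c) * w)
        - \<alpha> * a * c * q\<^sup>2 * ((1 - \<alpha> * x) * (1 - \<beta> * x) * w)"
      by (simp only: distr)
    thus ?thesis unfolding gx gy x_def .
  qed
  have "q_integral q (c * q) (a * q) h = (1 - q) * (g a - g c)"
  proof (rule q_integral_telescope[OF q1])
    fix n
    have "\<alpha> * (a * q ^ n) * q ^ Suc k \<noteq> 1" "\<beta> * (a * q ^ n) * q ^ Suc k \<noteq> 1"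
      "\<alpha> * (c * q ^ n) * q ^ Suc k \<noteq> 1" "\<beta> * (c * q ^ n) * q ^ Suc k \<noteq> 1" for k
      using nz[of "n + k"] by (auto simp: power_add mult_ac)
    from step[OF this(1,2)] step[OF this(3,4)]
    show "a * q ^ Suc n * h (a * q ^ Suc n) = g (a * q ^ n) - g (a * q ^ Suc n)"
      "c * q ^ Suc n * h (c * q ^ Suc n) = g (c * q ^ n) - g (c * q ^ Suc n)"
      by (simp_all add: mult_ac)
  next
    show "(\<lambda>n. g (a * q ^ n)) \<longlonglongrightarrow> \<alpha> * a * c * q\<^sup>2 * 1" "(\<lambda>n. g (c * q ^ n)) \<longlonglongrightarrow> \<alpha> * a * c * q\<^sup>2 * 1"
      unfolding g_def by (intro tendsto_intros aa_kernel_tendsto_1)+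
  qed
  moreover have "g a = 0" "g c = 0"
    using a c q1 by (simp_all add: g_def aa_kernel_def)
  ultimately have "q_integral q (c * q) (a * q) h = 0" by simp
  thus ?thesis
    unfolding h_def q_integral_lincomb[OF q1 aa_kernel_integrable aa_kernel_integrable]
      s_def[symmetric] t_def[symmetric] by simp
qed

text \<open>
  Dominated convergence: at the \<open>n\<close>-th node the kernel for \<open>\<alpha>q\<^sup>m\<close> is the kernel for \<open>0\<close> divided by
  \<open>(\<alpha>xq\<^sup>n\<^sup>+\<^sup>m; q)\<^sub>\<infinity>\<close>, which depends on \<open>n + m\<close> only and tends to \<open>1\<close>.  So the terms are bounded by a
  multiple of \<open>|q|\<^sup>n\<close> uniformly in \<open>m\<close>.
\<close>

lemma aa_integral_tendsto:
  "(\<lambda>m. aa_integral q a c (\<alpha> * q ^ m) \<beta>) \<longlonglongrightarrow> aa_integral q a c 0 \<beta>"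
proof -
  let ?f = "\<lambda>x n m. aa_kernel q a c (\<alpha> * q ^ m) \<beta> (x * q ^ n)"
  have factor: "?f x n m = aa_kernel q a c 0 \<beta> (x * q ^ n) / qpoch_inf (\<alpha> * x * q ^ (n + m)) q" for x n m
    by (simp add: aa_kernel_def q1 power_add mult_ac)
  have lim: "(\<lambda>m. ?f x n m) \<longlonglongrightarrow> aa_kernel q a c 0 \<beta> (x * q ^ n)" for x n
  proof -
    have "(\<lambda>m. aa_kernel q a c 0 \<beta> (x * q ^ n) / qpoch_inf (\<alpha> * x * q ^ n * q ^ m) q)
      \<longlonglongrightarrow> aa_kernel q a c 0 \<beta> (x * q ^ n) / 1"
      by (intro tendsto_intros qpoch_inf_tendsto_1[OF q1]) simp
    thus ?thesis unfolding factor by (simp add: power_add mult_ac)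
  qed
  have bounded: "\<exists>M. \<forall>n m. norm (?f x n m) \<le> M" for x
  proof -
    have "convergent (\<lambda>n. aa_kernel q a c 0 \<beta> (x * q ^ n))"
      using aa_kernel_tendsto_1 by (rule convergentI)
    then obtain A where A: "\<And>n. norm (aa_kernel q a c 0 \<beta> (x * q ^ n)) \<le> A"
      using BseqE[OF convergent_imp_Bseq] by metis
    have "(\<lambda>n. 1 / qpoch_inf (\<alpha> * x * q ^ n) q) \<longlonglongrightarrow> 1 / 1"
      by (intro tendsto_intros qpoch_inf_tendsto_1[OF q1]) simp
    hence "convergent (\<lambda>n. 1 / qpoch_inf (\<alpha> * x * q ^ n) q)" by (rule convergentI)
    then obtain B where B: "\<And>n. norm (1 / qpoch_inf (\<alpha> * x * q ^ n) q) \<le> B"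
      using BseqE[OF convergent_imp_Bseq] by metis
    have "norm (?f x n m) \<le> A * B" for n m
    proof -
      have "norm (?f x n m) = norm (aa_kernel q a c 0 \<beta> (x * q ^ n)) * norm (1 / qpoch_inf (\<alpha> * x * q ^ (n + m)) q)"
        unfolding factor by (simp add: norm_divide)
      also have "\<dots> \<le> A * B"
        by (intro mult_mono A B norm_ge_zero order_trans[OF norm_ge_zero A])
      finally show ?thesis .
    qed
    thus ?thesis by blast
  qed
  obtain A where A: "\<And>n m. norm (?f (a * q) n m) \<le> A" using bounded by blast
  obtain C where C: "\<And>n m. norm (?f (c * q) n m) \<le> C" using bounded by blast
  let ?s = "\<lambda>n m. (a * q * ?f (a * q) n m - c * q * ?f (c * q) n m) * q ^ n"
  let ?l = "\<lambda>n. (a * q * aa_kernel q a c 0 \<beta> (a * q * q ^ n)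
                  - c * q * aa_kernel q a c 0 \<beta> (c * q * q ^ n)) * q ^ n"
  let ?M = "\<lambda>n. (norm (a * q) * A + norm (c * q) * C) * norm q ^ n"
  have "norm (?s n m) \<le> ?M n" for n m
  proof -
    have "norm (a * q * ?f (a * q) n m - c * q * ?f (c * q) n m)
        \<le> norm (a * q) * norm (?f (a * q) n m) + norm (c * q) * norm (?f (c * q) n m)"
      unfolding norm_mult[symmetric] by (rule norm_triangle_ineq4)
    also have "\<dots> \<le> norm (a * q) * A + norm (c * q) * C"
      by (intro add_mono mult_left_mono A C norm_ge_zero)
    finally show ?thesis
      unfolding norm_mult[of _ "q ^ n"] norm_power by (rule mult_right_mono) simp
  qed
  moreover have "(\<lambda>m. ?s n m) \<longlonglongrightarrow> ?l n" for n
    by (intro tendsto_intros lim)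
  moreover have "summable ?M"
    using q1 by (intro summable_mult summable_geometric) simp
  ultimately have "(\<lambda>m. suminf (\<lambda>n. ?s n m)) \<longlonglongrightarrow> suminf ?l"
    by (intro tannerys_theorem[where M = ?M, THEN conjunct2, THEN conjunct2] always_eventually)
       (auto split: prod.split)
  hence "(\<lambda>m. (1 - q) * suminf (\<lambda>n. ?s n m)) \<longlonglongrightarrow> (1 - q) * suminf ?l"
    by (intro tendsto_intros)
  thus ?thesis unfolding q_integral_def .
qed

lemma aa_integral_remove_parameter:
  assumes a: "a \<noteq> 0" and c: "c \<noteq> 0"
    and nz: "\<And>k. \<alpha> * a * q ^ Suc k \<noteq> 1" "\<And>k. \<alpha> * c * q ^ Suc k \<noteq> 1"
      "\<And>k. \<beta> * a * q ^ Suc k \<noteq> 1" "\<And>k. \<beta> * c * q ^ Suc k \<noteq> 1"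
  shows "qpoch_inf (\<alpha> * a * q) q * qpoch_inf (\<alpha> * c * q) q * aa_integral q a c \<alpha> \<beta>
    = qpoch_inf (\<alpha> * \<beta> * a * c * q\<^sup>2) q * aa_integral q a c 0 \<beta>"
proof -
  have iterate: "qpoch (\<alpha> * a * q) q m * qpoch (\<alpha> * c * q) q m * aa_integral q a c \<alpha> \<beta>
      = qpoch (\<alpha> * \<beta> * a * c * q\<^sup>2) q m * aa_integral q a c (\<alpha> * q ^ m) \<beta>" for m
  proof (induction m)
    case (Suc m)
    let ?\<alpha> = "\<alpha> * q ^ m"
    have "\<And>k. ?\<alpha> * a * q ^ Suc k \<noteq> 1" "\<And>k. ?\<alpha> * c * q ^ Suc k \<noteq> 1"
      using nz(1,2)[of "m + _"] by (simp_all add: power_add mult_ac)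
    from aa_integral_contiguous[OF a c this nz(3,4)]
    have step: "(1 - ?\<alpha> * a * q) * (1 - ?\<alpha> * c * q) * aa_integral q a c ?\<alpha> \<beta>
      = (1 - ?\<alpha> * \<beta> * a * c * q\<^sup>2) * aa_integral q a c (\<alpha> * q ^ Suc m) \<beta>"
      by (simp add: mult_ac)
    have "qpoch (\<alpha> * a * q) q (Suc m) * qpoch (\<alpha> * c * q) q (Suc m) * aa_integral q a c \<alpha> \<beta>
      = (1 - ?\<alpha> * a * q) * (1 - ?\<alpha> * c * q) *
        (qpoch (\<alpha> * a * q) q m * qpoch (\<alpha> * c * q) q m * aa_integral q a c \<alpha> \<beta>)"
      by (simp add: qpoch_Suc mult_ac)
    also have "\<dots> = qpoch (\<alpha> * \<beta> * a * c * q\<^sup>2) q m *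
        ((1 - ?\<alpha> * a * q) * (1 - ?\<alpha> * c * q) * aa_integral q a c ?\<alpha> \<beta>)"
      unfolding Suc.IH by (simp only: mult_ac)
    also have "\<dots> = qpoch (\<alpha> * \<beta> * a * c * q\<^sup>2) q (Suc m) * aa_integral q a c (\<alpha> * q ^ Suc m) \<beta>"
      unfolding step qpoch_Suc by (simp add: mult_ac)
    finally show ?case .
  qed simp
  show ?thesis
  proof (rule LIMSEQ_unique)
    show "(\<lambda>m. qpoch (\<alpha> * a * q) q m * qpoch (\<alpha> * c * q) q m * aa_integral q a c \<alpha> \<beta>)
       \<longlonglongrightarrow> qpoch_inf (\<alpha> * a * q) q * qpoch_inf (\<alpha> * c * q) q * aa_integral q a c \<alpha> \<beta>"
      by (intro tendsto_intros qpoch_tendsto_qpoch_inf q1)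
    show "(\<lambda>m. qpoch (\<alpha> * a * q) q m * qpoch (\<alpha> * c * q) q m * aa_integral q a c \<alpha> \<beta>)
       \<longlonglongrightarrow> qpoch_inf (\<alpha> * \<beta> * a * c * q\<^sup>2) q * aa_integral q a c 0 \<beta>"
      unfolding iterate
      by (intro tendsto_intros qpoch_tendsto_qpoch_inf q1 aa_integral_tendsto)
  qed
qed

lemma aa_const_antisym: "aa_const q a c = - aa_const q c a"
  by (simp add: aa_const_def algebra_simps)

text \<open>
  At \<open>\<alpha> = 1/a\<close>, \<open>\<beta> = 0\<close> the kernel is \<open>(x/c; q)\<^sub>\<infinity>\<close> and the integral telescopes; removing the parameter
  \<open>\<alpha>\<close> again yields the constant.  The hypothesis says that \<open>\<alpha> = 1/a\<close> produces no zero denominator on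
  the lattice starting at \<open>cq\<close>.
\<close>

lemma aa_integral_0_0_generic:
  assumes a: "a \<noteq> 0" and c: "c \<noteq> 0" and ca: "\<And>k. c * q ^ Suc k \<noteq> a"
  shows "aa_integral q a c 0 0 = aa_const q a c"
proof -
  define h where "h = aa_kernel q a c (1 / a) 0"
  define g where "g = (\<lambda>x. - c * q * qpoch_inf (x / c) q)"
  have nz: "1 / a * a * q ^ Suc k \<noteq> 1" "1 / a * c * q ^ Suc k \<noteq> 1" for k
    using a ca[of k] power_Suc_neq_1[OF q1, of k] by (auto simp: field_simps)
  have step: "y * q * h (y * q) = g y - g (y * q)" if y: "\<And>k. y / a * q ^ Suc k \<noteq> 1" for y
  proof -
    have "qpoch_inf (y * q / a) q \<noteq> 0"
      using y by (intro qpoch_inf_nonzero[OF q1]) (simp add: mult_ac)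
    hence 1: "h (y * q) = qpoch_inf (y * q / c) q"
      by (simp add: h_def aa_kernel_def q1)
    have 2: "qpoch_inf (y / c) q = (1 - y / c) * qpoch_inf (y * q / c) q"
      using qpoch_inf_step[OF q1, of "y / c"] by simp
    show ?thesis unfolding g_def 1 2 using c by (simp add: field_simps)
  qed
  have "q_integral q (c * q) (a * q) h = (1 - q) * (g a - g c)"
  proof (rule q_integral_telescope[OF q1])
    fix n
    have "a * q ^ n / a * q ^ Suc k \<noteq> 1" "c * q ^ n / a * q ^ Suc k \<noteq> 1" for k
      using nz[of "n + k"] by (auto simp: power_add mult_ac)
    from step[OF this(1)] step[OF this(2)]
    show "a * q ^ Suc n * h (a * q ^ Suc n) = g (a * q ^ n) - g (a * q ^ Suc n)"
      "c * q ^ Suc n * h (c * q ^ Suc n) = g (c * q ^ n) - g (c * q ^ Suc n)"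
      by (simp_all add: mult_ac)
  next
    have "(\<lambda>n. - c * q * qpoch_inf (x / c * q ^ n) q) \<longlonglongrightarrow> - c * q * 1" for x
      by (intro tendsto_intros qpoch_inf_tendsto_1[OF q1])
    hence "(\<lambda>n. g (x * q ^ n)) \<longlonglongrightarrow> - c * q * 1" for x
      unfolding g_def by (simp only: times_divide_eq_left)
    thus "(\<lambda>n. g (a * q ^ n)) \<longlonglongrightarrow> - c * q * 1" "(\<lambda>n. g (c * q ^ n)) \<longlonglongrightarrow> - c * q * 1"
      by blast+
  qed
  also have "g a - g c = - c * q * (1 - a / c) * qpoch_inf (a * q / c) q"
    using c q1 qpoch_inf_step[OF q1, of "a / c"] by (simp add: g_def)
  also have "(1 - q) * \<dots> = q * (1 - q) * (a - c) * qpoch_inf (a * q / c) q"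
    using c by (simp add: field_simps)
  finally have "aa_integral q a c (1 / a) 0 = q * (1 - q) * (a - c) * qpoch_inf (a * q / c) q"
    unfolding h_def .
  moreover have "qpoch_inf (1 / a * a * q) q * qpoch_inf (1 / a * c * q) q * aa_integral q a c (1 / a) 0
      = qpoch_inf (1 / a * 0 * a * c * q\<^sup>2) q * aa_integral q a c 0 0"
    by (rule aa_integral_remove_parameter[OF a c nz]) simp_all
  ultimately show ?thesis
    using a q1 by (simp add: aa_const_def mult_ac)
qed

text \<open>
  In the excluded case \<open>a = cq\<^sup>k\<^sup>+\<^sup>1\<close> the roles of \<open>a\<close> and \<open>c\<close> are exchanged: both sides are antisymmetric,
  and \<open>c = aq\<^sup>j\<^sup>+\<^sup>1\<close> cannot hold at the same time.
\<close>

lemma aa_integral_0_0: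
  assumes a: "a \<noteq> 0" and c: "c \<noteq> 0"
  shows "aa_integral q a c 0 0 = aa_const q a c"
proof (cases "\<exists>k. c * q ^ Suc k = a")
  case False
  thus ?thesis using aa_integral_0_0_generic[OF a c] by blast
next
  case True
  then obtain k where k: "c * q ^ Suc k = a" by blast
  have "a * q ^ Suc j \<noteq> c" for j
  proof
    assume "a * q ^ Suc j = c"
    with k have "c * (q ^ Suc k * q ^ Suc j) = c" by (metis mult.assoc)
    with c have "q ^ (Suc k + Suc j) = 1" unfolding power_add by simp
    thus False using power_Suc_neq_1[OF q1, of "k + Suc j"] by simp
  qed
  hence "aa_integral q c a 0 0 = aa_const q c a" by (rule aa_integral_0_0_generic[OF c a])
  thus ?thesis
    using q_integral_swap[OF q1 aa_kernel_integrable, of "a * q" "c * q" a c 0 0] aa_const_antisym[of a c]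
    by (simp add: aa_kernel_swap[of a c])
qed

text \<open>
  The kernel is symmetric in \<open>\<alpha>\<close> and \<open>\<beta>\<close>, so both parameters can be removed, one after the other.
\<close>

theorem Andrews_Askey:
  assumes a: "a \<noteq> 0" and c: "c \<noteq> 0"
    and nz: "\<And>k. \<alpha> * a * q ^ Suc k \<noteq> 1" "\<And>k. \<alpha> * c * q ^ Suc k \<noteq> 1"
      "\<And>k. \<beta> * a * q ^ Suc k \<noteq> 1" "\<And>k. \<beta> * c * q ^ Suc k \<noteq> 1"
  shows "qpoch_inf (\<alpha> * a * q) q * qpoch_inf (\<alpha> * c * q) q *
     (qpoch_inf (\<beta> * a * q) q * qpoch_inf (\<beta> * c * q) q) * aa_integral q a c \<alpha> \<beta>
    = qpoch_inf (\<alpha> * \<beta> * a * c * q\<^sup>2) q * aa_const q a c"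
proof -
  let ?A = "qpoch_inf (\<alpha> * a * q) q * qpoch_inf (\<alpha> * c * q) q"
  let ?B = "qpoch_inf (\<beta> * a * q) q * qpoch_inf (\<beta> * c * q) q"
  have B: "?B * aa_integral q a c 0 \<beta> = aa_const q a c"
    using aa_integral_remove_parameter[OF a c nz(3,4), of 0] aa_integral_0_0[OF a c] q1
    by (simp add: aa_kernel_commute[of a c 0 \<beta>])
  have "?A * ?B * aa_integral q a c \<alpha> \<beta> = ?B * (?A * aa_integral q a c \<alpha> \<beta>)"
    by (simp only: mult_ac)
  also have "\<dots> = qpoch_inf (\<alpha> * \<beta> * a * c * q\<^sup>2) q * (?B * aa_integral q a c 0 \<beta>)"
    unfolding aa_integral_remove_parameter[OF a c nz] by (simp only: mult_ac)
  finally show ?thesis unfolding B .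
qed

text \<open>
  The constant is a theta function of \<open>a/c\<close> up to an elementary factor, hence quasi-periodic under
  \<open>a \<mapsto> aq\<close>.
\<close>

lemma aa_const_shift_1:
  assumes a: "a \<noteq> 0" and c: "c \<noteq> 0"
  shows "aa_const q (a * q) c = - (c / a) * aa_const q a c"
proof -
  have 1: "qpoch_inf (c * q / (a * q)) q = (1 - c / a) * qpoch_inf (c * q / a) q"
    using qpoch_inf_step[OF q1, of "c / a"] q0 by simp
  have 2: "qpoch_inf (a * q / c) q = (1 - a * q / c) * qpoch_inf (a * q * q / c) q"
    using qpoch_inf_step[OF q1, of "a * q / c"] by simp
  show ?thesis
    unfolding aa_const_def 1 2 using a c by (simp add: field_simps)
qed

lemma aa_const_shift:
  assumes a: "a \<noteq> 0" and c: "c \<noteq> 0"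
  shows "q ^ (j * (j - 1) div 2) * aa_const q (a * q ^ j) c = (- (c / a)) ^ j * aa_const q a c"
proof (induction j)
  case (Suc j)
  have e: "Suc j * (Suc j - 1) div 2 = j * (j - 1) div 2 + j"
    by (cases j) simp_all
  have "aa_const q (a * q ^ Suc j) c = - (c / (a * q ^ j)) * aa_const q (a * q ^ j) c"
    using aa_const_shift_1[of "a * q ^ j" c] a c q0 by (simp add: mult_ac)
  hence "q ^ j * aa_const q (a * q ^ Suc j) c = - (c / a) * aa_const q (a * q ^ j) c"
    using q0 by simp
  hence "q ^ (Suc j * (Suc j - 1) div 2) * aa_const q (a * q ^ Suc j) c
      = - (c / a) * (q ^ (j * (j - 1) div 2) * aa_const q (a * q ^ j) c)"
    unfolding e power_add mult.assoc by (simp only: mult.left_commute)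
  thus ?case
    unfolding Suc.IH by (simp only: power_Suc mult.assoc)
qed simp

end

section \<open>Products of linear factors and polynomial expansions\<close>

definition linprod :: "(nat \<Rightarrow> complex) \<Rightarrow> nat \<Rightarrow> complex poly" where
  "linprod d n = (\<Prod>i<n. [:1, - d i:])"

lemma poly_linprod: "poly (linprod d n) x = (\<Prod>i<n. 1 - d i * x)"
  by (simp add: linprod_def poly_prod mult.commute)

lemma linprod_Suc: "linprod d (Suc n) = linprod d n + smult (- d n) (pCons 0 (linprod d n))"
  by (simp add: linprod_def mult.commute[of "prod _ _"])

lemma degree_linprod: "degree (linprod d n) \<le> n"
proof (induction n)
  case (Suc n)
  have "degree (pCons 0 (linprod d n)) \<le> Suc n"
    using degree_pCons_le[of 0 "linprod d n"] Suc.IH by linarith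
  thus ?case
    unfolding linprod_Suc using Suc.IH by (intro degree_add_le order_trans[OF degree_smult_le]) simp_all
qed (simp add: linprod_def)

lemma coeff_linprod_top: "coeff (linprod d n) n = (\<Prod>i<n. - d i)"
proof (induction n)
  case (Suc n)
  have "coeff (linprod d n) (Suc n) = 0"
    using degree_linprod[of d n] by (intro coeff_eq_0) simp
  with Suc.IH show ?case by (simp add: linprod_Suc)
qed (simp add: linprod_def)

text \<open>
  The \<open>T j\<close> form a basis with \<open>T j\<close> of degree \<open>j\<close>.  For \<open>m < n\<close> the statement says that \<open>\<Lambda> (P * p)\<close>
  vanishes, and for \<open>m = n\<close> that only the leading coefficient of \<open>p\<close> matters; both follow by peeling off
  the top term of \<open>p\<close>.
\<close>

lemma functional_of_multiple_top_coeff: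
  fixes \<Lambda> :: "complex poly \<Rightarrow> complex"
  assumes lin: "\<And>s p r. \<Lambda> (p + smult s r) = \<Lambda> p + s * \<Lambda> r"
    and deg: "\<And>j. degree (T j) \<le> j" and top: "\<And>j. coeff (T j) j \<noteq> 0"
    and orth: "\<And>j. j < n \<Longrightarrow> \<Lambda> (P * T j) = 0"
  assumes "degree p \<le> m" "m \<le> n"
  shows "\<Lambda> (P * p) = coeff p m / coeff (T m) m * \<Lambda> (P * T m)"
  using assms(5,6)
proof (induction m arbitrary: p)
  case 0
  define s where "s = coeff p 0 / coeff (T 0) 0"
  have "degree (T 0) = 0" "degree p = 0" using deg[of 0] 0 by simp_all
  then obtain u v where "T 0 = [:u:]" "p = [:v:]" by (metis degree_eq_zeroE)
  with top[of 0] have "p = smult s (T 0)" by (simp add: s_def)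
  hence "P * p = 0 + smult s (P * T 0)" by simp
  hence "\<Lambda> (P * p) = \<Lambda> 0 + s * \<Lambda> (P * T 0)" by (simp only: lin)
  moreover have "\<Lambda> 0 = 0" using lin[of 0 1 0] by simp
  ultimately show ?case by (simp add: s_def)
next
  case (Suc m)
  define s where "s = coeff p (Suc m) / coeff (T (Suc m)) (Suc m)"
  define r where "r = p - smult s (T (Suc m))"
  have "degree r \<le> Suc m"
    unfolding r_def using Suc.prems deg[of "Suc m"]
    by (intro degree_diff_le order_trans[OF degree_smult_le])
  moreover have "coeff r (Suc m) = 0"
    using top[of "Suc m"] by (simp add: r_def s_def)
  ultimately have "degree r \<le> m"
    by (intro degree_le allI impI) (metis Suc_lessI coeff_eq_0 le_less_trans)
  hence "\<Lambda> (P * r) = 0"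
    using Suc.IH[of r] Suc.prems orth[of m] by simp
  moreover have "P * p = P * r + smult s (P * T (Suc m))"
    by (simp add: r_def algebra_simps)
  ultimately show ?case by (simp add: lin s_def)
qed

lemma prod_power_triangle: "(\<Prod>i<n. q ^ i) = (q :: complex) ^ (n * (n - 1) div 2)"
proof (induction n)
  case (Suc n)
  have "Suc n * (Suc n - 1) div 2 = n * (n - 1) div 2 + n"
    by (cases n) simp_all
  with Suc.IH show ?case by (simp add: power_add)
qed simp

lemma power_self_triangle: "((q :: complex) ^ n) ^ n = (q ^ (n * (n - 1) div 2))\<^sup>2 * q ^ n"
proof -
  have "even (n * (n - 1))" by (cases n) simp_all
  hence "n * n = n * (n - 1) div 2 * 2 + n"
    by (cases n) (simp_all add: algebra_simps)
  thus ?thesis by (metis power_add power_mult)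
qed

text \<open>
  Extracting \<open>-v q\<^sup>i\<close> from the \<open>i\<close>-th factor leaves the factors of \<open>(wq; q)\<^sub>n\<close> in reverse order.
\<close>

lemma prod_reverse_qpoch:
  "(\<Prod>i<n. v * w * q ^ n - v * q ^ i) = (- v) ^ n * q ^ (n * (n - 1) div 2) * qpoch (w * q) q n"
proof -
  have "(\<Prod>i<n. v * w * q ^ n - v * q ^ i) = (\<Prod>i<n. (- v) * q ^ i * (1 - w * q * q ^ (n - Suc i)))"
  proof (rule prod.cong[OF refl])
    fix i assume "i \<in> {..<n}"
    hence "n = i + Suc (n - Suc i)" by simp
    hence "q ^ n = q ^ i * (q * q ^ (n - Suc i))" by (metis power_add power_Suc)
    thus "v * w * q ^ n - v * q ^ i = (- v) * q ^ i * (1 - w * q * q ^ (n - Suc i))"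
      by (simp add: algebra_simps)
  qed
  also have "\<dots> = (- v) ^ n * q ^ (n * (n - 1) div 2) * (\<Prod>i<n. 1 - w * q * q ^ (n - Suc i))"
    by (simp only: prod.distrib prod_power_triangle prod_constant card_lessThan)
  also have "(\<Prod>i<n. 1 - w * q * q ^ (n - Suc i)) = qpoch (w * q) q n"
    unfolding qpoch_def by (rule prod.nat_diff_reindex)
  finally show ?thesis .
qed

lemma qpoch_neg_self:
  assumes "q \<noteq> 0"
  shows "(q ^ n) ^ n * qpoch (inverse q ^ n) q n = (- 1) ^ n * q ^ (n * (n - 1) div 2) * qpoch q q n"
proof -
  have "(q ^ n) ^ n * qpoch (inverse q ^ n) q n = (\<Prod>i<n. q ^ n * (1 - inverse q ^ n * q ^ i))"
    by (simp add: qpoch_def prod.distrib)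
  also have "\<dots> = (\<Prod>i<n. 1 * 1 * q ^ n - 1 * q ^ i)"
    using assms by (intro prod.cong refl) (simp add: field_simps)
  finally show ?thesis unfolding prod_reverse_qpoch by simp
qed

lemma prod_append_if:
  fixes j m :: nat and f g :: "nat \<Rightarrow> complex"
  shows
  "(\<Prod>i<j + m. if i < j then f i else g (i - j)) = (\<Prod>i<j. f i) * (\<Prod>i<m. g i)"
  by (induction m) simp_all

section \<open>Mixed moments and orthogonality of the big \<open>q\<close>-Jacobi polynomials\<close>

text \<open>
  The coefficients are grouped so that the weights of \<open>qdiff\<close> stand in front.
\<close>

definition big_q_jacobi_poly ::
  "complex \<Rightarrow> complex \<Rightarrow> complex \<Rightarrow> complex \<Rightarrow> nat \<Rightarrow> complex poly" where
  "big_q_jacobi_poly q a b c n =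
     (\<Sum>k\<le>n. smult (qpoch (inverse q ^ n) q k / qpoch q q k * q ^ k *
        (qpoch (a * b * q ^ Suc n) q k / (qpoch (a * q) q k * qpoch (c * q) q k)))
       (linprod (\<lambda>i. q ^ i) k))"

context
  fixes q a b c :: complex
  assumes q0: "q \<noteq> 0" and q1: "norm q < 1"
    and a: "a \<noteq> 0" and c: "c \<noteq> 0"
    and aq: "\<And>k. a * q ^ Suc k \<noteq> 1"
    and bq: "\<And>k. b * q ^ Suc k \<noteq> 1"
    and cq: "\<And>k. c * q ^ Suc k \<noteq> 1"
    and abq: "\<And>k. a * b * q ^ Suc k \<noteq> 1"
    and abcq: "\<And>k. a * b / c * q ^ Suc k \<noteq> 1"
begin

private abbreviation (input) w :: "complex \<Rightarrow> complex" where
  "w \<equiv> big_q_jacobi_weight q a b c"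

private abbreviation (input) \<Lambda> :: "complex poly \<Rightarrow> complex" where
  "\<Lambda> p \<equiv> q_integral q (c * q) (a * q) (\<lambda>x. w x * poly p x)"

private abbreviation (input) X :: "nat \<Rightarrow> complex poly" where
  "X k \<equiv> linprod (\<lambda>i. q ^ i) k"

private abbreviation (input) T :: "nat \<Rightarrow> complex poly" where
  "T j \<equiv> linprod (\<lambda>i. q ^ i / (a * q ^ j)) j"

lemma weight_eq_aa_kernel: "w = aa_kernel q a c 1 (b / c)"
  by (simp add: big_q_jacobi_weight_def qpochs_inf_def aa_kernel_def fun_eq_iff)

lemma weight_poly_convergent: "convergent (\<lambda>n. w (x * q ^ n) * poly p (x * q ^ n))"
proof -
  have "(\<lambda>n. w (x * q ^ n) * poly p (x * q ^ n)) \<longlonglongrightarrow> 1 * poly p 0"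
    unfolding weight_eq_aa_kernel
    by (intro tendsto_intros aa_kernel_tendsto_1[OF q0 q1] power_tendsto_0 q1)
  thus ?thesis by (rule convergentI)
qed

lemma weight_poly_integrable: "q_integrable q s t (\<lambda>x. w x * poly p x)"
  by (intro q_integrableI q1 weight_poly_convergent)

lemma functional_linear: "\<Lambda> (p + smult s r) = \<Lambda> p + s * \<Lambda> r"
proof -
  have "(\<lambda>x. w x * poly (p + smult s r) x) = (\<lambda>x. 1 * (w x * poly p x) + s * (w x * poly r x))"
    by (simp add: algebra_simps)
  thus ?thesis
    using q_integral_lincomb[OF q1 weight_poly_integrable weight_poly_integrable, of _ _ 1 p s r]
    by (simp only: mult_1)
qed

lemma functional_sum:
  fixes n :: nat
  shows "\<Lambda> (\<Sum>k\<le>n. smult (s k) (p k)) = (\<Sum>k\<le>n. s k * \<Lambda> (p k))"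
proof (induction n)
  case 0
  have "\<Lambda> 0 = 0" by (simp add: q_integral_def)
  thus ?case using functional_linear[of 0 "s 0" "p 0"] by simp
next
  case (Suc n)
  thus ?case by (simp only: sum.atMost_Suc functional_linear)
qed

text \<open>
  The two multiplications under which the kernels are stable: \<open>(x; q)\<^sub>k\<close> shortens the denominator
  \<open>(x; q)\<^sub>\<infinity>\<close>, and \<open>(x/(aq\<^sup>j); q)\<^sub>j\<close> extends the numerator \<open>(x/a; q)\<^sub>\<infinity>\<close>.
\<close>

lemma shifted_kernel:
  assumes "\<And>i. x * q ^ i \<noteq> 1"
  shows "aa_kernel q (a * q ^ j) c (q ^ k) \<beta> x = aa_kernel q a c 1 \<beta> x * poly (X k * T j) x"
proof -
  have 1: "qpoch_inf (x / (a * q ^ j)) q = poly (T j) x * qpoch_inf (x / a) q"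
    using qpoch_inf_split[OF q1, of "x / (a * q ^ j)" j] q0
    by (simp add: qpoch_def poly_linprod mult_ac)
  have 2: "qpoch_inf x q = poly (X k) x * qpoch_inf (q ^ k * x) q"
    using qpoch_inf_split[OF q1, of x k] by (simp add: qpoch_def poly_linprod mult_ac)
  have "qpoch_inf x q \<noteq> 0" by (intro qpoch_inf_nonzero q1 assms)
  with 2 have "poly (X k) x \<noteq> 0" by auto
  thus ?thesis unfolding aa_kernel_def 1 mult_1 2 by (simp add: mult_ac)
qed

lemma mixed_moment_as_aa_integral:
  "\<Lambda> (X k * T j) = aa_integral q (a * q ^ j) c (q ^ k) (b / c)"
proof -
  have a1: "a * q * q ^ n * q ^ i \<noteq> 1" and c1: "c * q * q ^ n * q ^ i \<noteq> 1" for n i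
    using aq[of "n + i"] cq[of "n + i"] by (simp_all add: power_add mult_ac)
  \<comment> \<open>The zeros aq, ..., aq^j of T j are the first j nodes, so the lattice may start at aq^(j + 1).\<close>
  have zero: "w (a * q * q ^ i) * poly (X k * T j) (a * q * q ^ i) = 0" if "i < j" for i
  proof -
    obtain m where m: "j = Suc (i + m)" using \<open>i < j\<close> less_iff_Suc_add by blast
    have "q ^ m / (a * q ^ j) * (a * q * q ^ i) = 1"
      using a q0 by (simp add: m power_add field_simps)
    hence "poly (T j) (a * q * q ^ i) = 0"
      unfolding poly_linprod by (intro prod_zero bexI[of _ m]) (simp, simp only: diff_self, simp add: m)
    thus ?thesis by simp
  qed
  have "\<Lambda> (X k * T j) = q_integral q (c * q) (a * q * q ^ j) (\<lambda>x. w x * poly (X k * T j) x)"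
    by (rule q_integral_shift_upper[OF q1 weight_poly_convergent weight_poly_convergent zero, symmetric])
  also have "\<dots> = q_integral q (c * q) (a * q * q ^ j) (aa_kernel q (a * q ^ j) c (q ^ k) (b / c))"
  proof (rule q_integral_cong[OF q1])
    show "w (c * q * q ^ n) * poly (X k * T j) (c * q * q ^ n)
        = aa_kernel q (a * q ^ j) c (q ^ k) (b / c) (c * q * q ^ n)" for n
      unfolding weight_eq_aa_kernel by (rule shifted_kernel[OF c1, symmetric])
    have "a * q * q ^ j * q ^ n * q ^ i \<noteq> 1" for n i
      using a1[of "j + n" i] by (simp add: power_add mult_ac)
    from shifted_kernel[OF this]
    show "w (a * q * q ^ j * q ^ n) * poly (X k * T j) (a * q * q ^ j * q ^ n)
        = aa_kernel q (a * q ^ j) c (q ^ k) (b / c) (a * q * q ^ j * q ^ n)" for n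
      unfolding weight_eq_aa_kernel by simp
  qed
  finally show ?thesis by (simp add: mult_ac)
qed

lemma pochhammers_nonzero:
  "qpoch (a * q) q n \<noteq> 0" "qpoch (b * q) q n \<noteq> 0" "qpoch (c * q) q n \<noteq> 0"
  "qpoch (a * b * q / c) q n \<noteq> 0" "qpoch (a * b * q ^ Suc j) q n \<noteq> 0"
  "qpoch_inf (a * q) q \<noteq> 0" "qpoch_inf (b * q) q \<noteq> 0" "qpoch_inf (c * q) q \<noteq> 0"
  "qpoch_inf (a * b * q / c) q \<noteq> 0"
proof -
  have "a * q * q ^ k \<noteq> 1" "b * q * q ^ k \<noteq> 1" "c * q * q ^ k \<noteq> 1" "a * b * q / c * q ^ k \<noteq> 1"
    "a * b * q ^ Suc j * q ^ k \<noteq> 1" for k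
    using aq[of k] bq[of k] cq[of k] abcq[of k] abq[of "j + k"] by (simp_all add: power_add mult_ac)
  note F = this
  show "qpoch (a * q) q n \<noteq> 0" "qpoch (b * q) q n \<noteq> 0" "qpoch (c * q) q n \<noteq> 0"
    "qpoch (a * b * q / c) q n \<noteq> 0" "qpoch (a * b * q ^ Suc j) q n \<noteq> 0"
    "qpoch_inf (a * q) q \<noteq> 0" "qpoch_inf (b * q) q \<noteq> 0" "qpoch_inf (c * q) q \<noteq> 0"
    "qpoch_inf (a * b * q / c) q \<noteq> 0"
    by (rule qpoch_nonzero qpoch_inf_nonzero[OF q1], rule F)+
qed

lemma mixed_moment_inf:
  "qpoch_inf (a * q * q ^ (k + j)) q * qpoch_inf (c * q * q ^ k) q *
     (qpoch_inf (a * b * q / c * q ^ j) q * qpoch_inf (b * q) q) * \<Lambda> (X k * T j)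
   = qpoch_inf (a * b * q ^ 2 * q ^ (k + j)) q * aa_const q (a * q ^ j) c"
proof -
  have nz: "q ^ k * (a * q ^ j) * q ^ Suc i \<noteq> 1" "q ^ k * c * q ^ Suc i \<noteq> 1"
    "b / c * (a * q ^ j) * q ^ Suc i \<noteq> 1" "b / c * c * q ^ Suc i \<noteq> 1" for i
    using aq[of "k + j + i"] cq[of "k + i"] abcq[of "j + i"] bq[of i] c
    by (simp_all add: power_add mult_ac)
  have "a * q ^ j \<noteq> 0" using a q0 by simp
  from Andrews_Askey[OF q0 q1 this c nz]
  show ?thesis
    unfolding mixed_moment_as_aa_integral using c by (simp add: power_add mult_ac)
qed

lemma total_mass:
  "\<Lambda> 1 = qpoch_inf (a * b * q\<^sup>2) q * aa_const q a c /
     (qpoch_inf (a * q) q * qpoch_inf (c * q) q * (qpoch_inf (a * b * q / c) q * qpoch_inf (b * q) q))"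
  using mixed_moment_inf[of 0 0] pochhammers_nonzero(6-9)
  by (simp add: linprod_def field_simps)

text \<open>
  In the quotient of the Andrews--Askey formulas with \<open>aq\<^sup>j\<close>, \<open>\<alpha> = q\<^sup>k\<close> and with \<open>a\<close>, \<open>\<alpha> = 1\<close> (both with
  \<open>\<beta> = b/c\<close>) only finite shifted factorials survive.
\<close>

lemma mixed_moment:
  "\<Lambda> (X k * T j) = \<Lambda> 1 * ((- (c / a)) ^ j / q ^ (j * (j - 1) div 2)) *
     (qpoch (a * q) q (k + j) * qpoch (c * q) q k * qpoch (a * b * q / c) q j / qpoch (a * b * q\<^sup>2) q (k + j))"
proof -
  note split = qpoch_inf_split[OF q1]
  define A where "A = qpoch_inf (a * q * q ^ (k + j)) q"
  define C where "C = qpoch_inf (c * q * q ^ k) q"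
  define D where "D = qpoch_inf (a * b * q / c * q ^ j) q"
  define E where "E = qpoch_inf (a * b * q ^ 2 * q ^ (k + j)) q"
  define B where "B = qpoch_inf (b * q) q"
  define K where "K = aa_const q a c"
  define t where "t = q ^ (j * (j - 1) div 2)"
  have t: "t \<noteq> 0" using q0 by (simp add: t_def)
  have A1: "qpoch_inf (a * q) q = qpoch (a * q) q (k + j) * A" unfolding A_def by (rule split)
  have C1: "qpoch_inf (c * q) q = qpoch (c * q) q k * C" unfolding C_def by (rule split)
  have D1: "qpoch_inf (a * b * q / c) q = qpoch (a * b * q / c) q j * D" unfolding D_def by (rule split)
  have E1: "qpoch_inf (a * b * q\<^sup>2) q = qpoch (a * b * q\<^sup>2) q (k + j) * E" unfolding E_def by (rule split)
  have nz: "A \<noteq> 0" "C \<noteq> 0" "D \<noteq> 0" "B \<noteq> 0"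
    using pochhammers_nonzero(6-9) unfolding A1 C1 D1 B_def by auto
  have nz2: "qpoch (a * b * q\<^sup>2) q (k + j) \<noteq> 0"
    using pochhammers_nonzero(5)[of 1] by (simp add: power2_eq_square)
  have "A * C * (D * B) * \<Lambda> (X k * T j) = E * aa_const q (a * q ^ j) c"
    using mixed_moment_inf[of k j] unfolding A_def B_def C_def D_def E_def .
  hence L: "\<Lambda> (X k * T j) = E * aa_const q (a * q ^ j) c / (A * C * (D * B))"
    using nz by (simp add: eq_divide_eq mult.commute)
  have S: "aa_const q (a * q ^ j) c = (- (c / a)) ^ j * K / t"
    using aa_const_shift[OF q0 q1 a c, of j] t unfolding t_def K_def by (simp add: eq_divide_eq mult.commute)
  show ?thesis
    unfolding L S total_mass A1 C1 D1 E1 K_def[symmetric] B_def[symmetric] t_def[symmetric]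
    using nz nz2 t pochhammers_nonzero(1)[of "k + j"] pochhammers_nonzero(3)[of k] pochhammers_nonzero(4)[of j]
    by (simp add: divide_simps mult_ac)
qed

private abbreviation (input) jcoeff :: "nat \<Rightarrow> nat \<Rightarrow> complex" where
  "jcoeff n k \<equiv> qpoch (inverse q ^ n) q k / qpoch q q k * q ^ k *
     (qpoch (a * b * q ^ Suc n) q k / (qpoch (a * q) q k * qpoch (c * q) q k))"

lemma big_q_jacobi_eq_poly: "big_q_jacobi q n a b c x = poly (big_q_jacobi_poly q a b c n) x"
proof -
  let ?t = "\<lambda>k. qpochs [q powi - int n, a * b * q ^ (n + 1), x] q k / qpochs [q, q * a, q * c] q k * q ^ k"
  have pow: "q powi - int n = inverse q ^ n"
    by (simp add: power_int_minus power_inverse)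
  have "suminf ?t = (\<Sum>k\<le>n. ?t k)"
    using qpoch_neg_eq_0[OF q0, of n]
    by (intro suminf_finite) (simp_all add: qpochs_def pow)
  also have "\<dots> = (\<Sum>k\<le>n. jcoeff n k * poly (X k) x)"
    by (intro sum.cong refl) (simp add: qpochs_def pow poly_linprod qpoch_def mult_ac)
  finally show ?thesis
    by (simp add: big_q_jacobi_def phi32_def big_q_jacobi_poly_def poly_sum)
qed

lemma degree_jacobi_poly: "degree (big_q_jacobi_poly q a b c n) \<le> n"
  unfolding big_q_jacobi_poly_def
  by (intro degree_sum_le order_trans[OF degree_smult_le] order_trans[OF degree_linprod]) simp_all

lemma coeff_jacobi_poly_top:
  "coeff (big_q_jacobi_poly q a b c n) n = qpoch (a * b * q ^ Suc n) q n / (qpoch (a * q) q n * qpoch (c * q) q n)"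
proof -
  define t where "t = q ^ (n * (n - 1) div 2)"
  have t: "t \<noteq> 0" using q0 by (simp add: t_def)
  have "(q ^ n) ^ n = t\<^sup>2 * q ^ n" unfolding t_def by (rule power_self_triangle)
  with qpoch_neg_self[OF q0, of n]
  have Q: "qpoch (inverse q ^ n) q n = (- 1) ^ n * qpoch q q n / (t * q ^ n)"
    using t q0 unfolding t_def[symmetric] by (simp add: field_simps power2_eq_square)
  have "coeff (X k) n = 0" if "k < n" for k
    using degree_linprod[of _ k] that by (intro coeff_eq_0) (meson le_less_trans)
  hence "coeff (big_q_jacobi_poly q a b c n) n = jcoeff n n * coeff (X n) n"
    unfolding big_q_jacobi_poly_def coeff_sum coeff_smult
    by (subst sum.mono_neutral_right[where S = "{n}"]) auto
  also have "coeff (X n) n = (- 1) ^ n * t"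
    by (simp add: coeff_linprod_top prod_uminus prod_power_triangle t_def)
  finally show ?thesis
    unfolding Q using t q0 qpoch_q_nonzero[OF q1, of n] pochhammers_nonzero(1,3)[of n]
    by (simp add: divide_simps)
qed

lemma jacobi_times_T:
  assumes "j \<le> n"
  shows "\<Lambda> (big_q_jacobi_poly q a b c n * T j) = \<Lambda> 1 * ((- (c / a)) ^ j / q ^ (j * (j - 1) div 2)) * qpoch (a * b * q / c) q j *
    qdiff q n (\<lambda>k. qpoch (a * b * q ^ Suc n) q k * qpoch (a * q) q (k + j) /
                   (qpoch (a * q) q k * qpoch (a * b * q\<^sup>2) q (k + j)))"
proof -
  have "big_q_jacobi_poly q a b c n * T j = (\<Sum>k\<le>n. smult (jcoeff n k) (X k * T j))"
    by (simp add: big_q_jacobi_poly_def sum_distrib_right)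
  hence expand: "\<Lambda> (big_q_jacobi_poly q a b c n * T j) = (\<Sum>k\<le>n. jcoeff n k * \<Lambda> (X k * T j))"
    by (simp only: functional_sum)
  have cancel: "y * (r / (s * u)) * (l * (v * u * w / e)) = l * w * (y * (r * v / (s * e)))"
    if "u \<noteq> 0" for y r s u l v w e :: complex
    using that by simp
  note expand
  also have "(\<Sum>k\<le>n. jcoeff n k * \<Lambda> (X k * T j)) = (\<Sum>k\<le>n. \<Lambda> 1 * ((- (c / a)) ^ j / q ^ (j * (j - 1) div 2)) * qpoch (a * b * q / c) q j *
     (qpoch (inverse q ^ n) q k / qpoch q q k * q ^ k *
       (qpoch (a * b * q ^ Suc n) q k * qpoch (a * q) q (k + j) /
                   (qpoch (a * q) q k * qpoch (a * b * q\<^sup>2) q (k + j)))))"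
    unfolding mixed_moment by (intro sum.cong refl cancel pochhammers_nonzero)
  finally show ?thesis unfolding qdiff_def sum_distrib_left .
qed

text \<open>
  With \<open>n = j + m\<close>, the quotient \<open>(abq\<^sup>n\<^sup>+\<^sup>1; q)\<^sub>k / (abq\<^sup>j\<^sup>+\<^sup>2; q)\<^sub>k\<close> is a polynomial of degree \<open>m\<close> in \<open>q\<^sup>k\<close> divided by
  \<open>1 - zq\<^sup>k\<close>, and \<open>(aq; q)\<^sub>k\<^sub>+\<^sub>j / (aq; q)\<^sub>k\<close> is a polynomial of degree \<open>j\<close>.  For \<open>m > 0\<close> the denominator cancels
  against a factor; keeping it makes the degree of the numerator equal to \<open>n\<close> in all cases.
\<close>

lemma ratio_as_product:
  fixes j m k :: nat
  defines "z \<equiv> a * b * q ^ Suc j"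
  shows "qpoch (a * b * q ^ Suc (j + m)) q k * qpoch (a * q) q (k + j) /
                   (qpoch (a * q) q k * qpoch (a * b * q\<^sup>2) q (k + j))
    = (1 - z) / (qpoch z q m * qpoch (a * b * q\<^sup>2) q j) *
      ((q ^ k) ^ 0 * (\<Prod>i<j + m. 1 - (if i < j then a * q * q ^ i else z * q ^ (i - j)) * q ^ k) / (1 - z * q ^ k))"
proof -
  have z: "qpoch z q i \<noteq> 0" for i unfolding z_def by (rule pochhammers_nonzero)
  have z1: "1 - z * q ^ i \<noteq> 0" for i
    using abq[of "j + i"] by (simp add: z_def power_add mult_ac)
  have 1: "qpoch (a * b * q ^ Suc (j + m)) q k = qpoch z q k * qpoch (z * q ^ k) q m / qpoch z q m"
    using qpoch_add[of z q m k] qpoch_add[of z q k m] z[of m]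
    by (simp add: z_def power_add mult_ac eq_divide_eq add.commute)
  have 2: "qpoch (a * b * q\<^sup>2) q (k + j) = qpoch (a * b * q\<^sup>2) q j * (qpoch z q k * (1 - z * q ^ k) / (1 - z))"
    using qpoch_add[of "a * b * q\<^sup>2" q j k] qpoch_Suc_shift[of z q k] qpoch_Suc[of z q k] z1[of 0]
    by (simp add: z_def power_add mult_ac eq_divide_eq add.commute power2_eq_square)
  have 3: "qpoch (a * q) q (k + j) = qpoch (a * q) q k * qpoch (a * q * q ^ k) q j"
    by (rule qpoch_add)
  have "(\<Prod>i<j + m. 1 - (if i < j then a * q * q ^ i else z * q ^ (i - j)) * q ^ k)
      = (\<Prod>i<j + m. if i < j then 1 - a * q * q ^ i * q ^ k else 1 - z * q ^ (i - j) * q ^ k)"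
    by (intro prod.cong) auto
  also have "\<dots> = qpoch (a * q * q ^ k) q j * qpoch (z * q ^ k) q m"
    unfolding prod_append_if[where f = "\<lambda>i. 1 - a * q * q ^ i * q ^ k" and g = "\<lambda>i. 1 - z * q ^ i * q ^ k"]
      qpoch_def by (simp add: mult_ac)
  finally have 4: "(\<Prod>i<j + m. 1 - (if i < j then a * q * q ^ i else z * q ^ (i - j)) * q ^ k)
     = qpoch (a * q * q ^ k) q j * qpoch (z * q ^ k) q m" .
  have nz: "qpoch (a * b * q\<^sup>2) q j \<noteq> 0" "qpoch (a * q) q k \<noteq> 0" "1 - z \<noteq> 0"
    using pochhammers_nonzero(5)[of 1 j] pochhammers_nonzero(1)[of k] z1[of 0] by (simp_all add: power2_eq_square)
  show ?thesis
    unfolding 1 2 3 4 using nz z[of m] z[of k] z1[of k] by (simp add: divide_simps)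
qed

lemma jacobi_times_T_product:
  fixes j m :: nat
  defines "z \<equiv> a * b * q ^ Suc j"
  shows "\<Lambda> (big_q_jacobi_poly q a b c (j + m) * T j) =
    \<Lambda> 1 * ((- (c / a)) ^ j / q ^ (j * (j - 1) div 2)) * qpoch (a * b * q / c) q j *
    ((1 - z) / (qpoch z q m * qpoch (a * b * q\<^sup>2) q j) *
      ((\<Prod>i<j + m. z - (if i < j then a * q * q ^ i else z * q ^ (i - j))) *
        qpoch q q (j + m) / qpoch z q (Suc (j + m))))"
proof -
  have z1: "z * q ^ i \<noteq> 1" for i
    using abq[of "j + i"] by (simp add: z_def power_add mult_ac)
  show ?thesis
    unfolding jacobi_times_T[OF le_add1] ratio_as_product z_def[symmetric] qdiff_cmult[OF q0 q1]
    by (subst qdiff_product_over_linear[OF q0 q1 z1]) simp_all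
qed

text \<open>
  The numerator factor with index \<open>j\<close> is the denominator \<open>1 - zq\<^sup>k\<close> itself, so the product of the
  \<open>z - c\<^sub>i\<close> contains a zero.
\<close>

lemma jacobi_orthogonal_T: "j < n \<Longrightarrow> \<Lambda> (big_q_jacobi_poly q a b c n * T j) = 0"
proof -
  assume "j < n"
  then obtain m where n: "n = j + Suc m" using less_iff_Suc_add by auto
  have "(\<Prod>i<j + Suc m. z - (if i < j then a * q * q ^ i else z * q ^ (i - j))) = 0" for z
    by (intro prod_zero bexI[of _ j]) auto
  thus ?thesis
    unfolding n jacobi_times_T_product by (simp only: mult_zero_left mult_zero_right div_0)
qed

lemma jacobi_times_T_self:
  "\<Lambda> (big_q_jacobi_poly q a b c n * T n) = \<Lambda> 1 * (c * q) ^ n *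
     (qpoch (a * b * q / c) q n * qpoch (b * q) q n * qpoch q q n /
       (qpoch (a * b * q\<^sup>2) q n * qpoch (a * b * q ^ Suc (Suc n)) q n))"
proof -
  define z where "z = a * b * q ^ Suc n"
  define t where "t = q ^ (n * (n - 1) div 2)"
  have t: "t \<noteq> 0" using q0 by (simp add: t_def)
  have "(\<Prod>i<n. z - (if i < n then a * q * q ^ i else z * q ^ (i - n))) = (\<Prod>i<n. a * q * b * q ^ n - a * q * q ^ i)"
    by (intro prod.cong refl) (simp add: z_def mult_ac)
  also have "\<dots> = (- (a * q)) ^ n * t * qpoch (b * q) q n"
    unfolding t_def by (rule prod_reverse_qpoch)
  finally have P: "(\<Prod>i<n. z - (if i < n then a * q * q ^ i else z * q ^ (i - n)))
     = (- (a * q)) ^ n * t * qpoch (b * q) q n" .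
  have Z: "qpoch z q (Suc n) = (1 - z) * qpoch (a * b * q ^ Suc (Suc n)) q n"
    by (simp add: qpoch_Suc_shift z_def mult_ac)
  have "1 - z \<noteq> 0" using abq[of n] by (simp add: z_def)
  moreover have "(- (c / a)) ^ n * (- (a * q)) ^ n = (c * q) ^ n"
    using a by (simp flip: power_mult_distrib)
  ultimately show ?thesis
    using jacobi_times_T_product[of n 0] t
    unfolding add_0_right z_def[symmetric] P Z t_def[symmetric] by (simp add: mult_ac)
qed

lemma coeff_T_top: "coeff (T n) n * (- (a * q ^ n)) ^ n = q ^ (n * (n - 1) div 2)"
proof -
  have "coeff (T n) n = (\<Prod>i<n. q ^ i * (1 / - (a * q ^ n)))"
    unfolding coeff_linprod_top by (intro prod.cong) simp_all
  also have "\<dots> = q ^ (n * (n - 1) div 2) * (1 / - (a * q ^ n)) ^ n"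
    by (simp only: prod.distrib prod_power_triangle prod_constant card_lessThan)
  finally have "coeff (T n) n * (- (a * q ^ n)) ^ n
      = q ^ (n * (n - 1) div 2) * (1 / - (a * q ^ n) * - (a * q ^ n)) ^ n"
    by (simp only: power_mult_distrib mult.assoc)
  also have "1 / - (a * q ^ n) * - (a * q ^ n) = 1"
    using a q0 by simp
  finally show ?thesis by simp
qed

lemma coeff_T_top_nonzero: "coeff (T n) n \<noteq> 0"
  using coeff_T_top[of n] q0 by auto

lemma jacobi_times_poly:
  assumes "degree p \<le> n"
  shows "\<Lambda> (big_q_jacobi_poly q a b c n * p) = coeff p n / coeff (T n) n * \<Lambda> (big_q_jacobi_poly q a b c n * T n)"
  by (rule functional_of_multiple_top_coeff[where \<Lambda> = \<Lambda> and T = T and n = n,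
        OF functional_linear degree_linprod coeff_T_top_nonzero jacobi_orthogonal_T assms order_refl])

lemma jacobi_orthogonal: "m \<noteq> n \<Longrightarrow> \<Lambda> (big_q_jacobi_poly q a b c m * big_q_jacobi_poly q a b c n) = 0"
proof (induction m n rule: linorder_wlog)
  case (le m n)
  hence "degree (big_q_jacobi_poly q a b c m) < n" using degree_jacobi_poly[of m] by linarith
  hence "\<Lambda> (big_q_jacobi_poly q a b c n * big_q_jacobi_poly q a b c m) = 0"
    by (subst jacobi_times_poly) (simp_all add: coeff_eq_0)
  thus ?case by (simp only: mult.commute)
next
  case (sym m n)
  thus ?case by (simp only: mult.commute) 
qed

text \<open>
  The leading coefficients of \<open>P\<^sub>n\<close> and \<open>T\<^sub>n\<close> convert the integral of \<open>w P\<^sub>n T\<^sub>n\<close> into that of \<open>w P\<^sub>n\<^sup>2\<close>; the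
  factors containing \<open>ab\<close> collapse because \<open>(abq; q)\<^sub>2\<^sub>n\<^sub>+\<^sub>1\<close> equals both
  \<open>(abq; q)\<^sub>n (abq\<^sup>n\<^sup>+\<^sup>1; q)\<^sub>n (1 - abq\<^sup>2\<^sup>n\<^sup>+\<^sup>1)\<close> and \<open>(1 - abq) (abq\<^sup>2; q)\<^sub>n (abq\<^sup>n\<^sup>+\<^sup>2; q)\<^sub>n\<close>.
\<close>

lemma jacobi_norm:
  "\<Lambda> (big_q_jacobi_poly q a b c n * big_q_jacobi_poly q a b c n) = \<Lambda> 1 *
     ((1 - a * b * q) * (qpoch q q n * qpoch (b * q) q n * qpoch (a * b * q / c) q n) /
      ((1 - a * b * q ^ (2 * n + 1)) * (qpoch (a * q) q n * qpoch (a * b * q) q n * qpoch (c * q) q n))) *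
     (- a * c * q\<^sup>2) ^ n * q ^ (n * (n - 1) div 2)"
proof -
  define t where "t = q ^ (n * (n - 1) div 2)"
  have t: "t \<noteq> 0" using q0 by (simp add: t_def)
  define U where "U = qpoch (a * b * q) q n"
  define V where "V = qpoch (a * b * q ^ Suc n) q n"
  define u where "u = 1 - a * b * q"
  define v where "v = 1 - a * b * q ^ (2 * n + 1)"
  define V' where "V' = qpoch (a * b * q ^ Suc (Suc n)) q n"
  define U' where "U' = qpoch (a * b * q\<^sup>2) q n"
  have nz: "U \<noteq> 0" "V \<noteq> 0" "u \<noteq> 0" "v \<noteq> 0" "V' \<noteq> 0" "U' \<noteq> 0"
    using pochhammers_nonzero(5)[of 0 n] pochhammers_nonzero(5)[of n n] pochhammers_nonzero(5)[of 1 n]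
      pochhammers_nonzero(5)[of "Suc n" n] abq[of 0] abq[of "2 * n"]
    by (simp_all add: U_def V_def u_def v_def V'_def U'_def power2_eq_square)
  have q2: "q ^ (2 * n + 1) = q * (q ^ n * q ^ n)"
    by (simp add: mult_2 power_add)
  have "(1 - a * b * q ^ Suc n) * V' = V * v"
    unfolding v_def q2
    using qpoch_Suc[of "a * b * q ^ Suc n" q n] qpoch_Suc_shift[of "a * b * q ^ Suc n" q n]
    by (simp add: V_def V'_def mult_ac)
  moreover have "u * U' = U * (1 - a * b * q ^ Suc n)"
    using qpoch_Suc[of "a * b * q" q n] qpoch_Suc_shift[of "a * b * q" q n]
    by (simp add: U_def U'_def u_def mult_ac power2_eq_square)
  ultimately have UV: "V / (U' * V') = u / (v * U)"
    using nz by (simp add: divide_simps) (metis mult.assoc mult.commute)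
  \<comment> \<open>The power q^(n^2) from the leading coefficient of T n is q^n times the square of t = q^(n(n-1)/2).\<close>
  have p: "(- (a * q ^ n)) ^ n * (c * q) ^ n = t * t * (- a * c * q\<^sup>2) ^ n"
    using power_self_triangle[of q n]
    by (simp add: t_def power_mult_distrib power2_eq_square power_minus[of "a * _"] power_minus[of a] mult_ac)
  have T1: "1 / coeff (T n) n = (- (a * q ^ n)) ^ n / t"
    using coeff_T_top[of n] t coeff_T_top_nonzero[of n] by (simp add: t_def field_simps)
  have "\<Lambda> (big_q_jacobi_poly q a b c n * big_q_jacobi_poly q a b c n) = coeff (big_q_jacobi_poly q a b c n) n * (1 / coeff (T n) n) * \<Lambda> (big_q_jacobi_poly q a b c n * T n)"
    using jacobi_times_poly[OF degree_jacobi_poly, of n] by simp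
  also have "\<dots> = \<Lambda> 1 * ((- (a * q ^ n)) ^ n * (c * q) ^ n) / t * (V / (U' * V')) *
     (qpoch q q n * qpoch (b * q) q n * qpoch (a * b * q / c) q n) / (qpoch (a * q) q n * qpoch (c * q) q n)"
    unfolding T1 coeff_jacobi_poly_top jacobi_times_T_self V_def[symmetric] U'_def[symmetric] V'_def[symmetric]
    by (simp add: mult_ac)
  also have "\<dots> = \<Lambda> 1 *
     (u * (qpoch q q n * qpoch (b * q) q n * qpoch (a * b * q / c) q n) /
      (v * (qpoch (a * q) q n * U * qpoch (c * q) q n))) *
     (- a * c * q\<^sup>2) ^ n * t"
    unfolding p UV using t by (simp add: mult_ac)
  finally show ?thesis unfolding u_def v_def U_def t_def .
qed

lemma total_mass_explicit:
  "\<Lambda> 1 = a * q * (1 - q) *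
     (qpochs_inf [q, a * b * q\<^sup>2, c / a, q * a / c] q /
      qpochs_inf [a * q, b * q, c * q, a * b * q / c] q)"
proof -
  have 1: "qpoch_inf (c / a) q = (1 - c / a) * qpoch_inf (c * q / a) q"
    using qpoch_inf_step[OF q1, of "c / a"] by simp
  have "aa_const q a c = a * q * (1 - q) * (qpoch_inf q q * qpoch_inf (c / a) q * qpoch_inf (a * q / c) q)"
    unfolding aa_const_def 1 using a by (simp add: field_simps)
  thus ?thesis unfolding total_mass by (simp add: qpochs_inf_def mult_ac)
qed

end

theorem theorem4p4:
  fixes q a b c :: complex
  assumes q: "q \<noteq> 0" "norm q < 1"
    and a: "a \<noteq> 0" and c: "c \<noteq> 0"
    and aq: "\<And>k::nat. a * q ^ (k + 1) \<noteq> 1"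
    and bq: "\<And>k::nat. b * q ^ (k + 1) \<noteq> 1"
    and cq: "\<And>k::nat. c * q ^ (k + 1) \<noteq> 1"
    and abq: "\<And>k::nat. a * b * q ^ (k + 1) \<noteq> 1"
    and abcq: "\<And>k::nat. a * b / c * q ^ (k + 1) \<noteq> 1"
  shows "\<forall>m n :: nat.
    q_integrable q (c * q) (a * q)
      (\<lambda>x. big_q_jacobi_weight q a b c x * big_q_jacobi q m a b c x * big_q_jacobi q n a b c x) \<and>
    q_integral q (c * q) (a * q)
      (\<lambda>x. big_q_jacobi_weight q a b c x * big_q_jacobi q m a b c x * big_q_jacobi q n a b c x) =
    a * q * (1 - q) *
    (qpochs_inf [q, a * b * q\<^sup>2, c / a, q * a / c] q /
     qpochs_inf [a * q, b * q, c * q, a * b * q / c] q) *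
    ((1 - a * b * q) * qpochs [q, q * b, a * b * q / c] q n /
     ((1 - a * b * q ^ (2 * n + 1)) * qpochs [a * q, a * b * q, c * q] q n)) *
    (- a * c * q\<^sup>2) ^ n * q ^ (n * (n - 1) div 2) *
    (if m = n then 1 else 0)"
proof -
  note conds = q a c aq[unfolded Suc_eq_plus1[symmetric]] bq[unfolded Suc_eq_plus1[symmetric]]
    cq[unfolded Suc_eq_plus1[symmetric]] abq[unfolded Suc_eq_plus1[symmetric]]
    abcq[unfolded Suc_eq_plus1[symmetric]]
  let ?J = "big_q_jacobi_poly q a b c"
  have integrand: "(\<lambda>x. big_q_jacobi_weight q a b c x * big_q_jacobi q m a b c x * big_q_jacobi q n a b c x)
      = (\<lambda>x. big_q_jacobi_weight q a b c x * poly (?J m * ?J n) x)" for m n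
    by (simp add: big_q_jacobi_eq_poly[OF conds] mult_ac)
  show ?thesis
    unfolding integrand total_mass_explicit[OF conds, symmetric]
  proof (intro allI conjI weight_poly_integrable[OF conds], goal_cases)
    case (1 m n)
    show ?case
      using jacobi_orthogonal[OF conds, of m n] jacobi_norm[OF conds, of n]
      by (cases "m = n") (simp_all add: qpochs_def mult_ac)
  qed
qed

end
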